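(* Let $(W,S)$ be an arbitrary Coxeter system with Coxeter graph $\Pi$, let $\sigma\in\mathrm{Aut}(\Pi)$, and let $\mathbf{C}$ be a $\sigma$-conjugacy class consisting of $\sigma$-involutions. (1) Every minimal length element of $\mathbf{C}$ is equal to $w_J$ for some spherical subset $J\subseteq S$ (possibly empty) with the property that $sw_J=w_Js^{\sigma}$ for all $s\in J$. (2) If $w_J$ and $w_{J'}$ are minimal length elements of $\mathbf{C}$ then $J'=wJw^{-\sigma}$ for some $w\in W$. (3) If $w\in\mathbf{C}$ then there exists $v\in W$ with $\ell(v^{-1}wv^{\sigma})=\ell(w)-2\ell(v)$ and $v^{-1}wv^{\sigma}=w_J$ for some spherical subset $J\subseteq S$ with $w_J$ of minimal length in $\mathbf{C}$.
   Context: $\ell$ is the length function. The automorphism $\sigma$ of the Coxeter graph induces an automorphism $w\mapsto w^\sigma$ of $W$; $w^{-\sigma}=(w^{-1})^\sigma$. The $\sigma$-conjugacy class of $w$ is $\{v^{-1}wv^\sigma\mid v\in W\}$. An element $w\in W$ is a $\sigma$-involution if $\sigma^2=1$ and $ww^\sigma=1$. A subset $J\subseteq S$ is spherical if $W_J=\langle J\rangle$ is finite; then $w_J$ denotes the longest element of $W_J$. For $J\subseteq S$, $wJw^{-\sigma}=\{wsw^{-\sigma}\mid s\in J\}$. *)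

theory Defs
  imports "HOL-Algebra.Algebra"
begin

section \<open>Coxeter systems\<close>

definition word_prod :: "('a, 'b) monoid_scheme \<Rightarrow> 'a list \<Rightarrow> 'a" where
  "word_prod G u = foldr (\<otimes>\<^bsub>G\<^esub>) u \<one>\<^bsub>G\<^esub>"

text \<open>The order \<open>m(s,t)\<close> of \<open>st\<close>. Following \<^const>\<open>group.ord\<close>, the value \<open>0\<close> stands for \<open>\<infinity>\<close>.\<close>

definition coxeter_m :: "('a, 'b) monoid_scheme \<Rightarrow> 'a \<Rightarrow> 'a \<Rightarrow> nat" where
  "coxeter_m G s t = group.ord G (s \<otimes>\<^bsub>G\<^esub> t)"

text \<open>The congruence on the free monoid \<^term>\<open>lists S\<close> generated by \<open>(st)\<^bsup>m(s,t)\<^esup> = 1\<close>. The relations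
  with \<open>s = t\<close> read \<open>ss = 1\<close>, so the quotient is already a group and coincides with the group
  presented by these relations. For \<open>m(s,t) = \<infinity>\<close>, encoded as \<open>0\<close>, the relation is void.\<close>

inductive coxeter_cong :: "('a, 'b) monoid_scheme \<Rightarrow> 'a set \<Rightarrow> 'a list \<Rightarrow> 'a list \<Rightarrow> bool"
  for G :: "('a, 'b) monoid_scheme" and S :: "'a set" where
  rel: "s \<in> S \<Longrightarrow> t \<in> S \<Longrightarrow> coxeter_cong G S (concat (replicate (coxeter_m G s t) [s, t])) []"
| refl: "u \<in> lists S \<Longrightarrow> coxeter_cong G S u u"
| sym: "coxeter_cong G S u v \<Longrightarrow> coxeter_cong G S v u"
| trans: "coxeter_cong G S u v \<Longrightarrow> coxeter_cong G S v w \<Longrightarrow> coxeter_cong G S u w"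
| append: "coxeter_cong G S u u' \<Longrightarrow> coxeter_cong G S v v' \<Longrightarrow> coxeter_cong G S (u @ v) (u' @ v')"

text \<open>As in Bourbaki: \<open>S\<close> is a generating set of elements of order 2, and \<open>S\<close> with the relations
  \<open>(st)\<^bsup>m(s,t)\<^esup> = 1\<close> is a presentation of the group. The set \<open>S\<close> may be infinite.\<close>

locale coxeter_system = group G for G :: "('a, 'b) monoid_scheme" (structure) +
  fixes S :: "'a set"
  assumes gens_closed: "S \<subseteq> carrier G"
    and gens_order: "s \<in> S \<Longrightarrow> ord s = 2"
    and gens_generate: "generate G S = carrier G"
    and presentation: "u \<in> lists S \<Longrightarrow> v \<in> lists S \<Longrightarrow> word_prod G u = word_prod G v \<Longrightarrow> coxeter_cong G S u v"

definition coxeter_length :: "('a, 'b) monoid_scheme \<Rightarrow> 'a set \<Rightarrow> 'a \<Rightarrow> nat" where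
  "coxeter_length G S w = (LEAST n. \<exists>u \<in> lists S. length u = n \<and> word_prod G u = w)"

text \<open>The labelled edges of the Coxeter graph with vertex set \<open>S\<close>: there is an edge wherever
  \<open>m(s,t) \<ge> 3\<close> or \<open>m(s,t) = \<infinity>\<close>.\<close>

definition coxeter_edges :: "('a, 'b) monoid_scheme \<Rightarrow> 'a set \<Rightarrow> ('a \<times> 'a \<times> nat) set" where
  "coxeter_edges G S = {(s, t, m). s \<in> S \<and> t \<in> S \<and> m = coxeter_m G s t \<and> (m \<ge> 3 \<or> m = 0)}"

definition coxeter_graph_aut :: "('a, 'b) monoid_scheme \<Rightarrow> 'a set \<Rightarrow> ('a \<Rightarrow> 'a) \<Rightarrow> bool" where
  "coxeter_graph_aut G S \<sigma> \<longleftrightarrow> bij_betw \<sigma> S S \<and>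
     (\<forall>s\<in>S. \<forall>t\<in>S. \<forall>m. (s, t, m) \<in> coxeter_edges G S \<longleftrightarrow> (\<sigma> s, \<sigma> t, m) \<in> coxeter_edges G S)"

text \<open>The map \<open>w \<mapsto> w\<^sup>\<sigma>\<close>; existence and uniqueness are shown in \<open>twist_ex1\<close> below.\<close>

definition twist :: "('a, 'b) monoid_scheme \<Rightarrow> 'a set \<Rightarrow> ('a \<Rightarrow> 'a) \<Rightarrow> 'a \<Rightarrow> 'a" where
  "twist G S \<sigma> = (THE \<phi>. \<phi> \<in> auto G \<and> (\<forall>s\<in>S. \<phi> s = \<sigma> s))"

definition spherical :: "('a, 'b) monoid_scheme \<Rightarrow> 'a set \<Rightarrow> 'a set \<Rightarrow> bool" where
  "spherical G S J \<longleftrightarrow> J \<subseteq> S \<and> finite (generate G J)"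

definition longest_elem :: "('a, 'b) monoid_scheme \<Rightarrow> 'a set \<Rightarrow> 'a set \<Rightarrow> 'a" where
  "longest_elem G S J =
     (THE w. w \<in> generate G J \<and> (\<forall>u \<in> generate G J. coxeter_length G S u \<le> coxeter_length G S w))"


section \<open>Twisted conjugacy classes and involutions\<close>

definition twisted_class :: "('a, 'b) monoid_scheme \<Rightarrow> 'a set \<Rightarrow> ('a \<Rightarrow> 'a) \<Rightarrow> 'a \<Rightarrow> 'a set" where
  "twisted_class G S \<sigma> w = {inv\<^bsub>G\<^esub> v \<otimes>\<^bsub>G\<^esub> w \<otimes>\<^bsub>G\<^esub> twist G S \<sigma> v | v. v \<in> carrier G}"

definition twisted_involution :: "('a, 'b) monoid_scheme \<Rightarrow> 'a set \<Rightarrow> ('a \<Rightarrow> 'a) \<Rightarrow> 'a \<Rightarrow> bool" where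
  "twisted_involution G S \<sigma> w \<longleftrightarrow>
     w \<in> carrier G \<and> (\<forall>s\<in>S. \<sigma> (\<sigma> s) = s) \<and> w \<otimes>\<^bsub>G\<^esub> twist G S \<sigma> w = \<one>\<^bsub>G\<^esub>"

definition min_length_elems :: "('a, 'b) monoid_scheme \<Rightarrow> 'a set \<Rightarrow> 'a set \<Rightarrow> 'a set" where
  "min_length_elems G S C = {w \<in> C. \<forall>u\<in>C. coxeter_length G S w \<le> coxeter_length G S u}"


section \<open>Graph automorphisms extend uniquely\<close>

context coxeter_system
begin

lemma word_prod_simps [simp]:
  "word_prod G [] = \<one>" "word_prod G (s # u) = s \<otimes> word_prod G u"
  by (simp_all add: word_prod_def)

lemma word_prod_closed: "u \<in> lists S \<Longrightarrow> word_prod G u \<in> carrier G"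
  using gens_closed by (induction u) auto

lemma word_prod_append:
  "u \<in> lists S \<Longrightarrow> v \<in> lists S \<Longrightarrow> word_prod G (u @ v) = word_prod G u \<otimes> word_prod G v"
proof (induction u)
  case (Cons s u)
  then show ?case using gens_closed word_prod_closed by (auto simp: m_assoc subset_iff)
qed (simp add: word_prod_closed)

lemma gens_sq: assumes "s \<in> S" shows "s \<otimes> s = \<one>"
proof -
  have c: "s \<in> carrier G" using gens_closed assms by auto
  have "s [^] (2::nat) = \<one>" using gens_order[OF assms] pow_ord_eq_1[OF c] by simp
  then show ?thesis using c by (simp add: numeral_2_eq_2)
qed

lemma word_prod_power:
  assumes "s \<in> S" "t \<in> S"
  shows "word_prod G (concat (replicate n [s, t])) = (s \<otimes> t) [^] n"
proof (induction n)
  case (Suc n)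
  have c: "s \<in> carrier G" "t \<in> carrier G" using gens_closed assms by auto
  have "(s \<otimes> t) [^] Suc n = (s \<otimes> t) \<otimes> (s \<otimes> t) [^] n" using c by (metis m_closed nat_pow_Suc2)
  then show ?case using Suc c by (simp add: m_assoc)
qed simp

lemma ex_word:
  assumes "w \<in> carrier G" obtains u where "u \<in> lists S" "word_prod G u = w"
proof -
  have "w \<in> generate G S" using assms gens_generate by simp
  then have "\<exists>u\<in>lists S. word_prod G u = w"
  proof (induction rule: generate.induct)
    case one
    then show ?case by (intro bexI[of _ "[]"]) auto
  next
    case (incl h)
    then show ?case using gens_closed by (intro bexI[of _ "[h]"]) auto
  next
    case (inv h)
    have "inv h = h" using gens_sq[OF inv] gens_closed inv by (metis inv_equality subsetD)
    then show ?case using gens_closed inv by (intro bexI[of _ "[h]"]) auto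
  next
    case (eng h1 h2)
    then obtain u v where "u \<in> lists S" "word_prod G u = h1" "v \<in> lists S" "word_prod G v = h2"
      by blast
    then show ?case by (intro bexI[of _ "u @ v"]) (auto simp: word_prod_append)
  qed
  then show ?thesis using that by blast
qed

lemma coxeter_m_same: "s \<in> S \<Longrightarrow> coxeter_m G s s = 1"
  by (simp add: coxeter_m_def gens_sq)

lemma coxeter_m_neq_1:
  assumes "s \<in> S" "t \<in> S" "s \<noteq> t" shows "coxeter_m G s t \<noteq> 1"
proof
  have c: "s \<in> carrier G" "t \<in> carrier G" using gens_closed assms by auto
  assume "coxeter_m G s t = 1"
  then have "s \<otimes> t = \<one>" using c ord_eq_1 by (simp add: coxeter_m_def)
  then have "s \<otimes> t = s \<otimes> s" using gens_sq assms by simp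
  then show False using c assms by simp
qed

lemma coxeter_graph_aut_m:
  assumes \<sigma>: "coxeter_graph_aut G S \<sigma>" and s: "s \<in> S" and t: "t \<in> S"
  shows "coxeter_m G (\<sigma> s) (\<sigma> t) = coxeter_m G s t"
proof (cases "s = t")
  case True
  have "\<sigma> s \<in> S" using \<sigma> s by (auto simp: coxeter_graph_aut_def bij_betw_def)
  then show ?thesis using True s by (simp add: coxeter_m_same)
next
  case False
  have b: "bij_betw \<sigma> S S" using \<sigma> by (simp add: coxeter_graph_aut_def)
  then have S: "\<sigma> s \<in> S" "\<sigma> t \<in> S" using s t by (auto simp: bij_betw_def)
  have ne: "\<sigma> s \<noteq> \<sigma> t" using b s t False by (auto simp: bij_betw_def inj_on_def)
  let ?m = "coxeter_m G s t" and ?m' = "coxeter_m G (\<sigma> s) (\<sigma> t)"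
  have E: "(s, t, m) \<in> coxeter_edges G S \<longleftrightarrow> (\<sigma> s, \<sigma> t, m) \<in> coxeter_edges G S" for m
    using \<sigma> s t by (simp add: coxeter_graph_aut_def)
  have "?m \<noteq> 1" "?m' \<noteq> 1" using coxeter_m_neq_1 s t S ne False by auto
  moreover have "?m = ?m' \<or> (\<not> (?m \<ge> 3 \<or> ?m = 0) \<and> \<not> (?m' \<ge> 3 \<or> ?m' = 0))"
    using E[of ?m] E[of ?m'] s t S by (auto simp: coxeter_edges_def)
  ultimately show ?thesis by linarith
qed

lemma word_prod_map:
  assumes \<sigma>: "coxeter_graph_aut G S \<sigma>"
    and "u \<in> lists S" "v \<in> lists S" "word_prod G u = word_prod G v"
  shows "word_prod G (map \<sigma> u) = word_prod G (map \<sigma> v)"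
proof -
  have im: "\<sigma> s \<in> S" if "s \<in> S" for s
    using \<sigma> that by (auto simp: coxeter_graph_aut_def bij_betw_def)
  have "u \<in> lists S \<and> v \<in> lists S \<and> word_prod G (map \<sigma> u) = word_prod G (map \<sigma> v)"
    if "coxeter_cong G S u v" for u v
    using that
  proof induction
    case (rel s t)
    have c: "\<sigma> s \<otimes> \<sigma> t \<in> carrier G" using im rel gens_closed by blast
    have "word_prod G (map \<sigma> (concat (replicate (coxeter_m G s t) [s, t])))
        = (\<sigma> s \<otimes> \<sigma> t) [^] coxeter_m G (\<sigma> s) (\<sigma> t)"
      using word_prod_power[of "\<sigma> s" "\<sigma> t"] im rel coxeter_graph_aut_m[OF \<sigma>]
      by (simp add: map_concat)
    also have "\<dots> = \<one>" using c by (simp add: coxeter_m_def)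
    finally show ?case using rel by (auto split: if_splits)
  next
    case (append u u' v v')
    moreover have "map \<sigma> x \<in> lists S" if "x \<in> lists S" for x
    using that by (auto simp: in_lists_conv_set im)
    ultimately show ?case by (simp add: word_prod_append)
  qed auto
  then show ?thesis using presentation assms by blast
qed

lemma hom_eqI:
  assumes "\<phi> \<in> hom G G" "\<psi> \<in> hom G G" "\<And>s. s \<in> S \<Longrightarrow> \<phi> s = \<psi> s" "w \<in> carrier G"
  shows "\<phi> w = \<psi> w"
proof -
  obtain u where u: "u \<in> lists S" "word_prod G u = w" using ex_word assms by blast
  have "\<phi> (word_prod G u) = \<psi> (word_prod G u)"
    using u(1)
  proof (induction u)
    case Nil
    then show ?case using hom_one[OF assms(1) is_group is_group] hom_one[OF assms(2) is_group is_group] by simp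
  next
    case (Cons s u)
    then show ?case using assms(1-3) gens_closed word_prod_closed
      by (auto simp: hom_mult subset_iff)
  qed
  then show ?thesis using u by simp
qed

lemma ex_extension:
  assumes \<sigma>: "coxeter_graph_aut G S \<sigma>"
  obtains \<phi> where "\<phi> \<in> hom G G" "\<And>s. s \<in> S \<Longrightarrow> \<phi> s = \<sigma> s"
proof -
  have im: "\<sigma> s \<in> S" if "s \<in> S" for s
    using \<sigma> that by (auto simp: coxeter_graph_aut_def bij_betw_def)
  have iml: "map \<sigma> u \<in> lists S" if "u \<in> lists S" for u
    using that by (auto simp: in_lists_conv_set im)
  define wd where "wd w = (SOME u. u \<in> lists S \<and> word_prod G u = w)" for w
  have wd: "wd w \<in> lists S \<and> word_prod G (wd w) = w" if "w \<in> carrier G" for w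
  proof -
    have "\<exists>u. u \<in> lists S \<and> word_prod G u = w" by (rule ex_word[OF that]) blast
    from someI_ex[OF this] show ?thesis unfolding wd_def .
  qed
  define \<phi> where "\<phi> w = word_prod G (map \<sigma> (wd w))" for w
  have \<phi>: "\<phi> (word_prod G u) = word_prod G (map \<sigma> u)" if "u \<in> lists S" for u
    unfolding \<phi>_def using wd[OF word_prod_closed[OF that]] that by (intro word_prod_map[OF \<sigma>]) auto
  have "\<phi> \<in> hom G G"
  proof (rule homI)
    fix x assume "x \<in> carrier G"
    then show "\<phi> x \<in> carrier G" unfolding \<phi>_def using wd[of x] iml[of "wd x"] by (simp add: word_prod_closed)
  next
    fix x y assume xy: "x \<in> carrier G" "y \<in> carrier G"
    have "\<phi> (x \<otimes> y) = \<phi> (word_prod G (wd x @ wd y))" using wd xy by (simp add: word_prod_append)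
    also have "\<dots> = word_prod G (map \<sigma> (wd x) @ map \<sigma> (wd y))" using wd xy \<phi> by simp
    also have "\<dots> = \<phi> x \<otimes> \<phi> y" unfolding \<phi>_def using wd xy iml by (simp add: word_prod_append)
    finally show "\<phi> (x \<otimes> y) = \<phi> x \<otimes> \<phi> y" .
  qed
  moreover have "\<phi> s = \<sigma> s" if "s \<in> S" for s
    using \<phi>[of "[s]"] that im gens_closed by (auto simp: subset_iff)
  ultimately show ?thesis using that by blast
qed

lemma coxeter_graph_aut_inv:
  assumes \<sigma>: "coxeter_graph_aut G S \<sigma>"
  shows "coxeter_graph_aut G S (inv_into S \<sigma>)"
proof -
  have b: "bij_betw \<sigma> S S" using \<sigma> by (simp add: coxeter_graph_aut_def)
  have "inv_into S \<sigma> s \<in> S \<and> \<sigma> (inv_into S \<sigma> s) = s" if "s \<in> S" for s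
    using b that by (metis bij_betw_def f_inv_into_f inv_into_into)
  then show ?thesis
    using \<sigma> bij_betw_inv_into[OF b] unfolding coxeter_graph_aut_def by metis
qed

lemma twist_ex1:
  assumes \<sigma>: "coxeter_graph_aut G S \<sigma>"
  shows "\<exists>!\<phi>. \<phi> \<in> auto G \<and> (\<forall>s\<in>S. \<phi> s = \<sigma> s)"
proof -
  have b: "bij_betw \<sigma> S S" using \<sigma> by (simp add: coxeter_graph_aut_def)
  obtain \<phi> where \<phi>: "\<phi> \<in> hom G G" "\<And>s. s \<in> S \<Longrightarrow> \<phi> s = \<sigma> s" by (rule ex_extension[OF \<sigma>]) blast
  obtain \<psi> where \<psi>: "\<psi> \<in> hom G G" "\<And>s. s \<in> S \<Longrightarrow> \<psi> s = inv_into S \<sigma> s"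
    by (rule ex_extension[OF coxeter_graph_aut_inv[OF \<sigma>]]) blast
  have id: "(\<lambda>x. x) \<in> hom G G" by (simp add: hom_def)
  have 1: "\<psi> (\<phi> w) = w" if "w \<in> carrier G" for w
  proof -
    have "(\<psi> \<circ> \<phi>) w = (\<lambda>x. x) w"
    proof (rule hom_eqI[OF _ id _ that])
      show "\<psi> \<circ> \<phi> \<in> hom G G" using \<phi>(1) \<psi>(1) by (auto simp: hom_def Pi_iff)
      show "(\<psi> \<circ> \<phi>) s = s" if "s \<in> S" for s
        using that \<phi>(2) \<psi>(2)[of "\<sigma> s"] b by (auto simp: bij_betw_def)
    qed
    then show ?thesis by simp
  qed
  have 2: "\<phi> (\<psi> w) = w" if "w \<in> carrier G" for w
  proof -
    have "(\<phi> \<circ> \<psi>) w = (\<lambda>x. x) w"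
    proof (rule hom_eqI[OF _ id _ that])
      show "\<phi> \<circ> \<psi> \<in> hom G G" using \<phi>(1) \<psi>(1) by (auto simp: hom_def Pi_iff)
      show "(\<phi> \<circ> \<psi>) s = s" if "s \<in> S" for s
        using that \<phi> \<psi> b by (metis bij_betw_def comp_apply f_inv_into_f inv_into_into)
    qed
    then show ?thesis by simp
  qed
  have "bij_betw \<phi> (carrier G) (carrier G)"
    using 1 2 \<phi>(1) \<psi>(1) by (intro bij_betw_byWitness[where f' = \<psi>]) (auto simp: hom_def)
  then have "restrict \<phi> (carrier G) \<in> auto G"
    using \<phi>(1) by (auto simp: auto_def Bij_def hom_def)
  moreover have "\<forall>s\<in>S. restrict \<phi> (carrier G) s = \<sigma> s" using \<phi> gens_closed by auto
  moreover have "f = g"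
    if "f \<in> auto G \<and> (\<forall>s\<in>S. f s = \<sigma> s)" "g \<in> auto G \<and> (\<forall>s\<in>S. g s = \<sigma> s)" for f g
  proof (rule extensionalityI)
    show "f \<in> extensional (carrier G)" "g \<in> extensional (carrier G)"
      using that by (auto simp: auto_def Bij_def)
    show "f x = g x" if "x \<in> carrier G" for x
      using hom_eqI[OF _ _ _ that] \<open>f \<in> auto G \<and> _\<close> \<open>g \<in> auto G \<and> _\<close> by (simp add: auto_def)
  qed
  ultimately show ?thesis by blast
qed

lemma twist_auto:
  assumes "coxeter_graph_aut G S \<sigma>"
  shows "twist G S \<sigma> \<in> auto G" "s \<in> S \<Longrightarrow> twist G S \<sigma> s = \<sigma> s"
proof -
  have "twist G S \<sigma> \<in> auto G \<and> (\<forall>s\<in>S. twist G S \<sigma> s = \<sigma> s)"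
    unfolding twist_def by (rule theI'[OF twist_ex1[OF assms]])
  then show "twist G S \<sigma> \<in> auto G" "s \<in> S \<Longrightarrow> twist G S \<sigma> s = \<sigma> s" by simp_all
qed

end

end

theory Submission
  imports Defs
begin

text \<open>
  The parity of the number of times a reflection is crossed by a word respects the Coxeter relations
  and hence defines the set \<open>N(w)\<close> of inversions of \<open>w\<close>, with \<open>\<ell>(w) = |N(w)|\<close>. This yields the
  exchange condition and minimal coset representatives for parabolic subgroups.

  If \<open>s\<close> is a left descent of a \<open>\<sigma>\<close>-involution \<open>w\<close>, then either \<open>sws\<^sup>\<sigma>\<close> is shorter by 2 or
  \<open>sw = ws\<^sup>\<sigma>\<close>. Descending as long as possible leads to a \<open>w\<close> of the second kind for all its left
  descents \<open>J\<close>, and this forces \<open>w = w\<^sub>J\<close>. It remains to compare two such elements \<open>w\<^sub>J\<close> and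
  \<open>w\<^sub>K = x\<^sup>-\<^sup>1w\<^sub>Jx\<^sup>\<sigma>\<close>. The reflections \<open>t\<close> with \<open>w\<^sub>Jt\<^sup>\<sigma> = tw\<^sub>J\<close> and \<open>t \<in> N(w\<^sub>J)\<close> are those of
  \<open>W\<^sub>J\<close>, and both conditions are compatible with twisted conjugation, so \<open>x\<^sup>-\<^sup>1W\<^sub>Jx = W\<^sub>K\<close>. The
  shortest element \<open>d\<close> of \<open>W\<^sub>Jx\<close> then satisfies \<open>d\<^sup>-\<^sup>1Jd = K\<close> and \<open>d\<^sup>\<sigma> = d\<close>; in particular
  \<open>w\<^sub>J\<close> and \<open>w\<^sub>K\<close> have the same length.
\<close>

context coxeter_system
begin

section \<open>Cancellation rules for inverses and generators\<close>

lemma inv_l_cancel [simp]: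
  "x \<in> carrier G \<Longrightarrow> y \<in> carrier G \<Longrightarrow> inv x \<otimes> (x \<otimes> y) = y"
  "x \<in> carrier G \<Longrightarrow> y \<in> carrier G \<Longrightarrow> x \<otimes> (inv x \<otimes> y) = y"
  by (simp_all flip: m_assoc)

lemma gen_carrier [simp]: "s \<in> S \<Longrightarrow> s \<in> carrier G"
  using gens_closed by blast

lemma gen_inv [simp]: "s \<in> S \<Longrightarrow> inv s = s"
  using gens_sq inv_equality by simp

lemma gen_cancel [simp]: "s \<in> S \<Longrightarrow> x \<in> carrier G \<Longrightarrow> s \<otimes> (s \<otimes> x) = x"
  using gens_sq[of s] by (simp flip: m_assoc)

declare gens_sq [simp]

abbreviation conj_by :: "'a \<Rightarrow> 'a \<Rightarrow> 'a" where
  "conj_by g r \<equiv> g \<otimes> r \<otimes> inv g"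

lemma conj_by_eq_iff:
  "\<lbrakk>g \<in> carrier G; r \<in> carrier G; r' \<in> carrier G\<rbrakk> \<Longrightarrow> conj_by g r = r' \<longleftrightarrow> r = conj_by (inv g) r'"
  by (auto simp: m_assoc)


section \<open>Inversions\<close>

text \<open>The number of occurrences of \<open>r\<close> among the reflections
  \<open>s\<^sub>1 \<cdots> s\<^sub>i \<cdots> s\<^sub>1\<close> attached to the prefixes of a word \<open>s\<^sub>1 \<cdots> s\<^sub>n\<close>.\<close>

primrec crossings :: "'a list \<Rightarrow> 'a \<Rightarrow> nat" where
  "crossings [] r = 0"
| "crossings (s # u) r = of_bool (r = s) + crossings u (s \<otimes> r \<otimes> s)"

text \<open>Each letter \<open>s\<close> replaces \<open>r\<close> by \<open>s r s\<close>, so after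
  all of \<open>u\<close> the tail sees \<open>r\<close> conjugated by the inverse of the product of
  \<open>u\<close>. This becomes the cocycle rule \<open>inversions_mult\<close>.\<close>

lemma crossings_append:
  "\<lbrakk>u \<in> lists S; v \<in> lists S; r \<in> carrier G\<rbrakk> \<Longrightarrow>
    crossings (u @ v) r = crossings u r + crossings v (conj_by (inv (word_prod G u)) r)"
proof (induction u arbitrary: r)
  case (Cons s u)
  then show ?case
    by (auto simp: word_prod_closed inv_mult_group m_assoc)
qed simp

text \<open>The reflections attached to the prefixes of \<open>(st)^k\<close> are
  \<open>p^j s\<close> with \<open>p = st\<close>. The induction strips the first two letters, which
  conjugates \<open>r\<close> by \<open>p^-1\<close> and shifts the exponent by two.\<close>

lemma crossings_power:
  assumes "s \<in> S" "t \<in> S" "r \<in> carrier G"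
  shows "crossings (concat (replicate k [s, t])) r
    = (\<Sum>j<2 * k. of_bool (r = (s \<otimes> t) [^] j \<otimes> s))"
  using assms(3)
proof (induction k arbitrary: r)
  case (Suc k)
  define p where "p = s \<otimes> t"
  have c: "p \<in> carrier G" "s \<in> carrier G" "t \<in> carrier G" using assms by (auto simp: p_def)
  have p: "inv p = t \<otimes> s" using assms by (simp add: p_def inv_mult_group)
  let ?r = "t \<otimes> (s \<otimes> r \<otimes> s) \<otimes> t"
  have r: "?r = conj_by (inv p) r" using assms Suc.prems by (simp add: p p_def inv_mult_group m_assoc)
  \<comment> \<open>The shift comes from \<open>s p^-1 = s t s = p s\<close>.\<close>
  have e: "?r = p [^] j \<otimes> s \<longleftrightarrow> r = p [^] Suc (Suc j) \<otimes> s" for j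
  proof -
    have "?r = p [^] j \<otimes> s \<longleftrightarrow> r = p \<otimes> (p [^] j \<otimes> s) \<otimes> inv p"
      unfolding r using c Suc.prems conj_by_eq_iff[of "inv p" r "p [^] j \<otimes> s"] by simp
    also have "p \<otimes> (p [^] j \<otimes> s) \<otimes> inv p = p \<otimes> p [^] j \<otimes> (s \<otimes> t \<otimes> s)"
      unfolding p using c by (simp add: m_assoc)
    also have "\<dots> = p \<otimes> p [^] j \<otimes> p \<otimes> s" using c by (simp add: p_def m_assoc)
    also have "p \<otimes> p [^] j \<otimes> p = p [^] Suc (Suc j)"
      using c by (metis nat_pow_Suc nat_pow_Suc2)
    finally show ?thesis .
  qed
  have e1: "s \<otimes> r \<otimes> s = t \<longleftrightarrow> r = p \<otimes> s"
    using conj_by_eq_iff[of s r t] assms Suc.prems c by (simp add: p_def)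
  have "crossings (concat (replicate (Suc k) [s, t])) r
      = of_bool (r = s) + (of_bool (s \<otimes> r \<otimes> s = t) + crossings (concat (replicate k [s, t])) ?r)"
    by simp
  also have "crossings (concat (replicate k [s, t])) ?r = (\<Sum>j<2 * k. of_bool (?r = p [^] j \<otimes> s))"
    using Suc.IH[of ?r] c Suc.prems unfolding p_def by simp
  also have "\<dots> = (\<Sum>j<2 * k. of_bool (r = p [^] Suc (Suc j) \<otimes> s))" unfolding e ..
  \<comment> \<open>The two stripped letters supply the terms for the exponents 0 and 1.\<close>
  also have "of_bool (r = s) + (of_bool (s \<otimes> r \<otimes> s = t) + \<dots>)
      = (\<Sum>j<2 * Suc k. of_bool (r = p [^] j \<otimes> s))"
    unfolding e1 using c by (simp add: sum.lessThan_Suc_shift del: sum.lessThan_Suc)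
  finally show ?case unfolding p_def .
qed simp

text \<open>Since \<open>p^m = 1\<close>, the second half of the exponents repeats the first, so
  every reflection is met an even number of times. For infinite order \<open>m\<close> is 0 and the
  word is empty.\<close>

lemma crossings_relation:
  assumes "s \<in> S" "t \<in> S" "r \<in> carrier G"
  shows "even (crossings (concat (replicate (coxeter_m G s t) [s, t])) r)"
proof -
  define m p where "m = coxeter_m G s t" and "p = s \<otimes> t"
  have c: "p \<in> carrier G" using assms by (simp add: p_def)
  have "p [^] m = \<one>" using c by (simp add: m_def p_def coxeter_m_def)
  then have p: "p [^] (m + j) = p [^] j" for j
    using c nat_pow_mult[of p m j] by simp
  let ?f = "\<lambda>j. of_bool (r = p [^] j \<otimes> s) :: nat"
  have "(\<Sum>j<2 * m. ?f j) = (\<Sum>j<m. ?f j) + (\<Sum>j<m. ?f (m + j))"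
  proof -
    have "(\<Sum>j<m + k. ?f j) = (\<Sum>j<m. ?f j) + (\<Sum>j<k. ?f (m + j))" for k
      by (induction k) simp_all
    then show ?thesis by (simp only: mult_2)
  qed
  then show ?thesis using crossings_power[OF assms, of m] p unfolding m_def p_def by simp
qed

text \<open>Equality of the products is carried along because, in the \<open>append\<close> case,
  the second factor is tested at \<open>r\<close> conjugated by the product of the first, which must
  agree for \<open>u\<close> and \<open>u'\<close>.\<close>

lemma coxeter_cong_crossings:
  assumes "coxeter_cong G S u v"
  shows "u \<in> lists S \<and> v \<in> lists S \<and> word_prod G u = word_prod G v \<and>
    (\<forall>r\<in>carrier G. even (crossings u r) = even (crossings v r))"
  using assms
proof induction
  case (rel s t)
  have "word_prod G (concat (replicate (coxeter_m G s t) [s, t])) = \<one>"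
    using rel by (simp add: word_prod_power coxeter_m_def)
  then show ?case using rel crossings_relation by (auto split: if_splits)
next
  case (append u u' v v')
  then show ?case
    using word_prod_closed[of u] by (simp add: crossings_append word_prod_append)
qed auto

text \<open>Any word for \<open>w\<close> may serve as witness: by
  \<open>inversions_word_prod\<close> the parity depends on \<open>w\<close> alone.\<close>

definition inversions :: "'a \<Rightarrow> 'a set" where
  "inversions w = {r \<in> carrier G. \<exists>u\<in>lists S. word_prod G u = w \<and> odd (crossings u r)}"

lemma inversions_word_prod:
  assumes "u \<in> lists S" "r \<in> carrier G"
  shows "r \<in> inversions (word_prod G u) \<longleftrightarrow> odd (crossings u r)"
proof -
  have "even (crossings v r) = even (crossings u r)"
    if "v \<in> lists S" "word_prod G v = word_prod G u" for v
    using coxeter_cong_crossings[OF presentation[OF that(1) assms(1) that(2)]] assms(2) by simp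
  then show ?thesis using assms unfolding inversions_def by blast
qed

lemma inversions_carrier: "r \<in> inversions w \<Longrightarrow> r \<in> carrier G"
  by (simp add: inversions_def)

lemma inversions_one [simp]: "inversions \<one> = {}"
proof -
  have "r \<notin> inversions \<one>" if "r \<in> carrier G" for r using inversions_word_prod[of "[]" r] that by simp
  then show ?thesis using inversions_carrier by blast
qed

lemma inversions_gen: assumes "s \<in> S" shows "inversions s = {s}"
proof -
  have "r \<in> inversions s \<longleftrightarrow> r = s" if "r \<in> carrier G" for r
    using inversions_word_prod[of "[s]" r] that assms by simp
  then show ?thesis using inversions_carrier gen_carrier[OF assms] by blast
qed

text \<open>Crossings of a concatenation add, and modulo 2 the sum is an exclusive or: N(xy) is the
  symmetric difference of N(x) and \<open>x N(y) x^-1\<close>. Most later facts on descents are read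
  off from this rule.\<close>

lemma inversions_mult:
  assumes "x \<in> carrier G" "y \<in> carrier G" "r \<in> carrier G"
  shows "r \<in> inversions (x \<otimes> y) \<longleftrightarrow> (r \<in> inversions x) \<noteq> (conj_by (inv x) r \<in> inversions y)"
proof -
  obtain u v where uv: "u \<in> lists S" "word_prod G u = x" "v \<in> lists S" "word_prod G v = y"
    using ex_word assms by metis
  then have "r \<in> inversions (x \<otimes> y) \<longleftrightarrow> odd (crossings (u @ v) r)"
    using inversions_word_prod[of "u @ v"] assms by (simp add: word_prod_append)
  also have "\<dots> \<longleftrightarrow> odd (crossings u r) \<noteq> odd (crossings v (conj_by (inv x) r))"
    using crossings_append[of u v r] uv assms by simp
  also have "odd (crossings u r) \<longleftrightarrow> r \<in> inversions x"
    using inversions_word_prod[of u r] uv assms by simp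
  also have "odd (crossings v (conj_by (inv x) r)) \<longleftrightarrow> conj_by (inv x) r \<in> inversions y"
    using inversions_word_prod[of v "conj_by (inv x) r"] uv assms by simp
  finally show ?thesis .
qed

lemma inversions_inv:
  assumes "x \<in> carrier G" "r \<in> carrier G"
  shows "conj_by (inv x) r \<in> inversions (inv x) \<longleftrightarrow> r \<in> inversions x"
  using inversions_mult[of x "inv x" r] assms by simp

section \<open>Reflections and their relation to inversions\<close>

definition reflections :: "'a set" where
  "reflections = {conj_by g s | g s. g \<in> carrier G \<and> s \<in> S}"

lemma gen_reflection: "s \<in> S \<Longrightarrow> s \<in> reflections"
  unfolding reflections_def by (auto intro!: exI[of _ \<one>] exI[of _ s])

lemma reflection_carrier: "r \<in> reflections \<Longrightarrow> r \<in> carrier G"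
  unfolding reflections_def by auto

lemma reflection_sq:
  assumes "r \<in> reflections" shows "r \<otimes> r = \<one>"
  using assms unfolding reflections_def by (auto simp: m_assoc)

text \<open>Expand along \<open>r = g s g^-1\<close> by \<open>inversions_mult\<close>: the
  contributions of \<open>g\<close> and \<open>g^-1\<close> cancel, and \<open>s\<close> contributes
  once.\<close>

lemma reflection_self_inversion:
  assumes "r \<in> reflections" shows "r \<in> inversions r"
proof -
  obtain g s where g: "g \<in> carrier G" and s: "s \<in> S" and r: "r = conj_by g s"
    using assms unfolding reflections_def by blast
  have c: "r \<in> carrier G" using g s r by simp
  have gr: "conj_by (inv g) r = s" using g s r by (simp add: m_assoc)
  have "r \<in> inversions (g \<otimes> (s \<otimes> inv g)) \<longleftrightarrow> (r \<in> inversions g) \<noteq> (s \<in> inversions (s \<otimes> inv g))"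
    using inversions_mult[of g "s \<otimes> inv g" r] g s c gr by simp
  also have "s \<in> inversions (s \<otimes> inv g) \<longleftrightarrow> s \<notin> inversions (inv g)"
    using inversions_mult[of s "inv g" s] g s by (simp add: inversions_gen m_assoc)
  also have "s \<in> inversions (inv g) \<longleftrightarrow> r \<in> inversions g"
    using inversions_inv[of g r] g c gr by simp
  finally show ?thesis using g s r by (simp add: m_assoc)
qed


section \<open>Length and the exchange condition\<close>

abbreviation len :: "'a \<Rightarrow> nat" ("\<ell>") where
  "\<ell> w \<equiv> coxeter_length G S w"

lemma len_le: "u \<in> lists S \<Longrightarrow> \<ell> (word_prod G u) \<le> length u"
  unfolding coxeter_length_def by (rule Least_le) blast

lemma ex_reduced_word:
  assumes "w \<in> carrier G"
  obtains u where "u \<in> lists S" "word_prod G u = w" "length u = \<ell> w"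
proof -
  have "\<exists>n. \<exists>u\<in>lists S. length u = n \<and> word_prod G u = w" using ex_word[OF assms] by metis
  from LeastI_ex[OF this] show ?thesis unfolding coxeter_length_def[symmetric] using that by blast
qed

lemma len_one [simp]: "\<ell> \<one> = 0"
  using len_le[of "[]"] by simp

lemma len_0_iff: "w \<in> carrier G \<Longrightarrow> \<ell> w = 0 \<longleftrightarrow> w = \<one>"
  by (metis ex_reduced_word length_0_conv len_one word_prod_simps(1))

lemma len_mult_le:
  assumes "x \<in> carrier G" "y \<in> carrier G" shows "\<ell> (x \<otimes> y) \<le> \<ell> x + \<ell> y"
proof -
  obtain u v where "u \<in> lists S" "word_prod G u = x" "length u = \<ell> x"
    "v \<in> lists S" "word_prod G v = y" "length v = \<ell> y"
    using assms ex_reduced_word by metis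
  then show ?thesis using len_le[of "u @ v"] by (simp add: word_prod_append)
qed

lemma len_gen_le: "s \<in> S \<Longrightarrow> \<ell> s \<le> 1"
  using len_le[of "[s]"] by simp

lemma len_inv_le:
  assumes "w \<in> carrier G" shows "\<ell> (inv w) \<le> \<ell> w"
proof -
  have *: "word_prod G (rev u) = inv (word_prod G u)" if "u \<in> lists S" for u
    using that
  proof (induction u)
    case (Cons s u)
    then show ?case using word_prod_append[of "rev u" "[s]"]
      by (simp add: inv_mult_group word_prod_closed in_lists_conv_set)
  qed simp
  obtain u where "u \<in> lists S" "word_prod G u = w" "length u = \<ell> w"
    using assms ex_reduced_word by metis
  then show ?thesis using len_le[of "rev u"] * by (simp add: in_lists_conv_set)
qed

lemma len_inv: "w \<in> carrier G \<Longrightarrow> \<ell> (inv w) = \<ell> w"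
  using len_inv_le[of w] len_inv_le[of "inv w"] by simp

text \<open>Left multiplication by \<open>r\<close> deletes a letter at which \<open>r\<close> is
  crossed. The new word is still over \<open>J\<close>, which is what the parabolic subgroups
  need.\<close>

lemma deletion:
  assumes "J \<subseteq> S" "u \<in> lists J" "r \<in> carrier G" "crossings u r > 0"
  obtains v where "v \<in> lists J" "length v < length u" "word_prod G v = r \<otimes> word_prod G u"
proof -
  have "\<exists>v\<in>lists J. length v < length u \<and> word_prod G v = r \<otimes> word_prod G u"
    using assms(2-)
  proof (induction u arbitrary: r)
    case (Cons s u)
    have s: "s \<in> S" "s \<in> J" and u: "u \<in> lists J" "u \<in> lists S"
      using Cons.hyps assms(1) lists_mono[OF assms(1)] by blast+
    show ?case
    proof (cases "r = s")
      case True
      then show ?thesis using s u by (intro bexI[of _ u]) (auto simp: word_prod_closed)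
    next
      case False
      then obtain v where "v \<in> lists J" "length v < length u"
        "word_prod G v = s \<otimes> r \<otimes> s \<otimes> word_prod G u"
        using Cons.IH[of "s \<otimes> r \<otimes> s"] Cons.prems s by auto
      then show ?thesis using s u Cons.prems
        by (intro bexI[of _ "s # v"]) (auto simp: word_prod_closed m_assoc)
    qed
  qed simp
  then show ?thesis using that by blast
qed

lemma inversion_imp_len_less:
  assumes "w \<in> carrier G" "r \<in> inversions w" shows "\<ell> (r \<otimes> w) < \<ell> w"
proof -
  obtain u where u: "u \<in> lists S" "word_prod G u = w" "length u = \<ell> w"
    using assms ex_reduced_word by metis
  then have "crossings u r > 0"
    using inversions_word_prod[of u r] assms inversions_carrier odd_pos by blast
  then obtain v where "v \<in> lists S" "length v < length u" "word_prod G v = r \<otimes> w"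
    using deletion[of S u r] u inversions_carrier[OF assms(2)] by blast
  then show ?thesis using len_le[of v] u by simp
qed

text \<open>For the converse, \<open>r\<close> lies in N(r) and is fixed by conjugation with itself,
  so it is an inversion of \<open>r w\<close> whenever it is not one of \<open>w\<close>;
  multiplying back by \<open>r\<close> would then shorten \<open>r w\<close>.\<close>

lemma inversion_iff:
  assumes "w \<in> carrier G" "r \<in> reflections"
  shows "r \<in> inversions w \<longleftrightarrow> \<ell> (r \<otimes> w) < \<ell> w"
proof
  assume less: "\<ell> (r \<otimes> w) < \<ell> w"
  have c: "r \<in> carrier G" and sq: "r \<otimes> r = \<one>"
    using assms reflection_carrier reflection_sq by auto
  have inv: "inv r = r" using c sq inv_equality by simp
  show "r \<in> inversions w"
  proof (rule ccontr)
    assume "r \<notin> inversions w"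
    then have "r \<in> inversions (r \<otimes> w)"
      using inversions_mult[of r w r] assms c reflection_self_inversion inv sq by simp
    then have "\<ell> (r \<otimes> (r \<otimes> w)) < \<ell> (r \<otimes> w)" using inversion_imp_len_less assms c by simp
    moreover have "r \<otimes> (r \<otimes> w) = w" using assms c sq by (simp flip: m_assoc)
    ultimately show False using less by simp
  qed
qed (use assms inversion_imp_len_less in simp)

lemma not_inversion_len:
  assumes "w \<in> carrier G" "s \<in> S" "s \<notin> inversions w" shows "\<ell> (s \<otimes> w) = \<ell> w + 1"
proof -
  have "s \<in> inversions (s \<otimes> w)"
    using inversions_mult[of s w s] assms by (simp add: inversions_gen m_assoc)
  then have "\<ell> w < \<ell> (s \<otimes> w)" using inversion_imp_len_less[of "s \<otimes> w" s] assms by simp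
  then show ?thesis using len_mult_le[of s w] len_gen_le[of s] assms by simp
qed

lemma inversion_len:
  assumes "w \<in> carrier G" "s \<in> S" "s \<in> inversions w" shows "\<ell> w = \<ell> (s \<otimes> w) + 1"
  using inversion_imp_len_less[of w s] len_mult_le[of s "s \<otimes> w"] len_gen_le[of s] assms by simp

text \<open>N(wt) and N(w) differ only in \<open>w t w^-1\<close>. Either \<open>s\<close> is this
  reflection, or \<open>s\<close> is still an inversion of \<open>wt\<close> and shortens it once
  more.\<close>

lemma exchange:
  assumes w: "w \<in> carrier G" and s: "s \<in> S" "s \<in> inversions w"
    and t: "t \<in> S" "\<ell> (w \<otimes> t) < \<ell> w"
  shows "s \<otimes> w = w \<otimes> t \<or> \<ell> (s \<otimes> w \<otimes> t) + 2 = \<ell> w"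
proof (cases "conj_by (inv w) s = t")
  case True
  then have "s = conj_by w t" using w s t by (auto simp: m_assoc)
  then show ?thesis using w t by (simp add: m_assoc)
next
  case False
  then have "s \<in> inversions (w \<otimes> t)"
    using inversions_mult[of w t s] w s t by (simp add: inversions_gen)
  then have "\<ell> (w \<otimes> t) = \<ell> (s \<otimes> w \<otimes> t) + 1" using inversion_len[of "w \<otimes> t" s] w s t by (simp add: m_assoc)
  moreover have "\<ell> w \<le> \<ell> (w \<otimes> t) + 1"
    using len_mult_le[of "w \<otimes> t" t] len_gen_le[of t] w t by (simp add: m_assoc)
  ultimately show ?thesis using t by simp
qed

lemma ex_left_descent:
  assumes "w \<in> carrier G" "w \<noteq> \<one>"
  obtains s where "s \<in> S" "s \<in> inversions w"
proof -
  obtain u where u: "u \<in> lists S" "word_prod G u = w" "length u = \<ell> w"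
    using assms ex_reduced_word by metis
  then obtain s v where sv: "u = s # v" "s \<in> S" "v \<in> lists S"
    using assms by (cases u) auto
  then have "s \<otimes> w = word_prod G v" using u word_prod_closed[of v] by auto
  then have "\<ell> (s \<otimes> w) < \<ell> w" using len_le[of v] u sv by simp
  then show ?thesis using that inversion_iff gen_reflection sv assms by blast
qed

section \<open>Length as the number of inversions\<close>

lemma inj_on_conj_by: "g \<in> carrier G \<Longrightarrow> A \<subseteq> carrier G \<Longrightarrow> inj_on (conj_by g) A"
  by (rule inj_on_inverseI[where g = "conj_by (inv g)"]) (auto simp: m_assoc)

lemma inversions_mult_disjoint:
  assumes "x \<in> carrier G" "y \<in> carrier G" "inversions x \<inter> conj_by x ` inversions y = {}"
  shows "inversions (x \<otimes> y) = inversions x \<union> conj_by x ` inversions y"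
proof -
  have mem: "conj_by (inv x) r \<in> inversions y \<longleftrightarrow> r \<in> conj_by x ` inversions y" if r: "r \<in> carrier G" for r
  proof
    assume "conj_by (inv x) r \<in> inversions y"
    moreover have "r = conj_by x (conj_by (inv x) r)" using assms r by (simp add: m_assoc)
    ultimately show "r \<in> conj_by x ` inversions y" by blast
  next
    assume "r \<in> conj_by x ` inversions y"
    then obtain q where q: "q \<in> inversions y" "r = conj_by x q" by blast
    moreover have "q \<in> carrier G" using q inversions_carrier by blast
    ultimately show "conj_by (inv x) r \<in> inversions y" using assms by (simp add: m_assoc)
  qed
  have "conj_by x ` inversions y \<subseteq> carrier G"
    using assms(1) inversions_carrier[of _ y] by blast
  moreover have "r \<in> inversions (x \<otimes> y) \<longleftrightarrow> r \<in> inversions x \<union> conj_by x ` inversions y"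
    if r: "r \<in> carrier G" for r
    unfolding inversions_mult[OF assms(1,2) r] mem[OF r] using assms(3) by blast
  ultimately show ?thesis
    using inversions_carrier[of _ x] inversions_carrier[of _ "x \<otimes> y"] by (intro Set.set_eqI) blast
qed

text \<open>Strip a left descent \<open>s\<close>: N(w) consists of \<open>s\<close> and a conjugate
  of N(v) for the shorter \<open>v = s w\<close>.\<close>

lemma card_inversions:
  assumes "w \<in> carrier G" shows "finite (inversions w) \<and> card (inversions w) = \<ell> w"
  using assms
proof (induction "\<ell> w" arbitrary: w rule: less_induct)
  case less
  show ?case
  proof (cases "w = \<one>")
    case False
    then obtain s where s: "s \<in> S" "s \<in> inversions w" using ex_left_descent less.prems by blast
    define v where "v = s \<otimes> w"
    have v: "v \<in> carrier G" "w = s \<otimes> v" using s less.prems by (simp_all add: v_def)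
    have len: "\<ell> w = \<ell> v + 1" using inversion_len s less.prems unfolding v_def by blast
    then have IH: "finite (inversions v)" "card (inversions v) = \<ell> v"
      using less.hyps[of v] v by auto
    have "s \<notin> inversions v"
      using len inversion_imp_len_less[of v s] v by auto
    moreover have "q = s" if "q \<in> inversions v" "s = conj_by s q" for q
      using conj_by_eq_iff[of s q s] that s inversions_carrier[OF that(1)] by simp
    \<comment> \<open>A \<open>q\<close> in N(v) with \<open>s = s q s\<close> would be
      \<open>s\<close> itself, which is no inversion of \<open>v\<close>.\<close>
    ultimately have new: "s \<notin> conj_by s ` inversions v" by blast
    then have "inversions w = insert s (conj_by s ` inversions v)"
      using inversions_mult_disjoint[of s v] s v by (simp add: inversions_gen)
    moreover have "inj_on (conj_by s) (inversions v)"
      using inj_on_conj_by s inversions_carrier by (meson gen_carrier subsetI)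
    ultimately show ?thesis using IH len new by (simp add: card_image)
  qed simp
qed

lemma len_mult_disjoint:
  assumes "x \<in> carrier G" "y \<in> carrier G" "inversions x \<inter> conj_by x ` inversions y = {}"
  shows "\<ell> (x \<otimes> y) = \<ell> x + \<ell> y"
proof -
  have "\<ell> (x \<otimes> y) = card (inversions x \<union> conj_by x ` inversions y)"
    using card_inversions[of "x \<otimes> y"] inversions_mult_disjoint assms by simp
  also have "\<dots> = card (inversions x) + card (conj_by x ` inversions y)"
    using card_inversions assms by (intro card_Un_disjoint) auto
  also have "card (conj_by x ` inversions y) = card (inversions y)"
    using inj_on_conj_by[of x "inversions y"] assms(1) inversions_carrier[of _ y]
    by (intro card_image) blast
  finally show ?thesis using card_inversions assms by simp
qed


section \<open>Parabolic subgroups\<close>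

lemma parabolic_subgroup: "J \<subseteq> S \<Longrightarrow> subgroup (generate G J) G"
  using gens_closed by (intro generate_is_subgroup) blast

lemma parabolic_carrier: "J \<subseteq> S \<Longrightarrow> w \<in> generate G J \<Longrightarrow> w \<in> carrier G"
  by (rule subgroup.mem_carrier[OF parabolic_subgroup])

lemmas parabolic_mult = subgroup.m_closed[OF parabolic_subgroup]
  and parabolic_inv = subgroup.m_inv_closed[OF parabolic_subgroup]
  and parabolic_one = subgroup.one_closed[OF parabolic_subgroup]

lemma word_prod_parabolic:
  assumes "J \<subseteq> S" "u \<in> lists J" shows "word_prod G u \<in> generate G J"
  using assms(2)
proof induction
  case (Cons s u)
  then show ?case using parabolic_mult[OF assms(1)] generate.incl[of s J G] by simp
qed (simp add: generate.one)

text \<open>The length is that of the whole group, so letters outside \<open>J\<close> never give a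
  shorter expression. Multiplying by a generator from \<open>J\<close> either prepends it or
  shortens the word by \<open>deletion\<close>; both keep it reduced and over
  \<open>J\<close>.\<close>

lemma parabolic_reduced_word:
  assumes J: "J \<subseteq> S" and w: "w \<in> generate G J"
  obtains u where "u \<in> lists J" "word_prod G u = w" "length u = \<ell> w"
proof -
  have J': "lists J \<subseteq> lists S" by (rule lists_mono[OF J])
  have gen: "\<exists>v\<in>lists J. word_prod G v = s \<otimes> w \<and> length v = \<ell> (s \<otimes> w)"
    if s: "s \<in> J" and v: "v \<in> lists J" "word_prod G v = w" "length v = \<ell> w" for s v w
  proof -
    have sS: "s \<in> S" and vS: "v \<in> lists S" using s v J J' by blast+
    then have w: "w \<in> carrier G" using word_prod_closed v(2) by metis
    show ?thesis
    proof (cases "s \<in> inversions w")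
      case False
      then show ?thesis using not_inversion_len[OF w sS] s v by (intro bexI[of _ "s # v"]) auto
    next
      case True
      then have "crossings v s > 0" using inversions_word_prod[of v s] v vS sS by (simp add: odd_pos)
      then obtain v' where v': "v' \<in> lists J" "length v' < length v" "word_prod G v' = s \<otimes> w"
        by (rule deletion[OF J v(1) gen_carrier[OF sS]]) (simp add: v(2))
      \<comment> \<open>As \<open>s w\<close> is exactly one shorter than \<open>w\<close>, the two
        bounds force \<open>v'\<close> to be reduced.\<close>
      moreover have "\<ell> (s \<otimes> w) \<le> length v'" using len_le[of v'] v' J' by auto
      ultimately show ?thesis using inversion_len[OF w sS True] v by (intro bexI[of _ v']) auto
    qed
  qed
  have mult: "\<exists>v\<in>lists J. word_prod G v = word_prod G u \<otimes> w \<and> length v = \<ell> (word_prod G u \<otimes> w)"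
    if "u \<in> lists J" "v \<in> lists J" "word_prod G v = w" "length v = \<ell> w" for u v w
    using that(1)
  proof induction
    case Nil
    have "v \<in> lists S" using that(2) J' by blast
    then have "w \<in> carrier G" using word_prod_closed[of v] that(3) by simp
    then show ?case using that by auto
  next
    case (Cons s u)
    have "v \<in> lists S" "u \<in> lists S" using Cons.hyps(2) that(2) J' by blast+
    then have "w \<in> carrier G" "word_prod G u \<in> carrier G"
      using word_prod_closed[of v] word_prod_closed[of u] that(3) by simp_all
    moreover have "s \<in> carrier G" using Cons.hyps(1) J by auto
    ultimately show ?case
      using Cons.IH gen[OF Cons.hyps(1), of _ "word_prod G u \<otimes> w"] by (auto simp: m_assoc simp del: in_lists_conv_set)
  qed
  from w have "\<exists>u\<in>lists J. word_prod G u = w \<and> length u = \<ell> w"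
  proof induction
    case one
    show ?case by (intro bexI[of _ "[]"]) auto
  next
    case (incl s)
    then have "s \<in> S" using J by blast
    then show ?case using gen[of s "[]" \<one>] incl by (simp del: in_lists_conv_set)
  next
    case (inv s)
    then have "s \<in> S" using J by blast
    then show ?case using gen[of s "[]" \<one>] inv by (simp del: in_lists_conv_set)
  next
    case (eng x y)
    then obtain u v where "u \<in> lists J" "word_prod G u = x"
      "v \<in> lists J" "word_prod G v = y" "length v = \<ell> y"
      by blast
    then show ?case using mult[of u v y] by simp
  qed
  then show ?thesis using that by blast
qed

lemma parabolic_gen:
  assumes "J \<subseteq> S" "s \<in> generate G J" "\<ell> s = 1" shows "s \<in> J"
proof -
  obtain u where u: "u \<in> lists J" "word_prod G u = s" "length u = 1"
    using parabolic_reduced_word assms by metis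
  then obtain t where "u = [t]" "t \<in> J" by (auto simp: length_Suc_conv)
  then show ?thesis using u assms(1) by auto
qed

lemma parabolic_descent:
  assumes "J \<subseteq> S" "w \<in> generate G J" "w \<noteq> \<one>"
  obtains s where "s \<in> J" "s \<in> inversions w"
proof -
  obtain u where u: "u \<in> lists J" "word_prod G u = w" "length u = \<ell> w"
    using parabolic_reduced_word assms by metis
  then obtain s v where v: "u = s # v" "s \<in> J" "v \<in> lists J" using assms by (cases u) auto
  have vS: "s \<in> S" "v \<in> lists S" using v assms(1) lists_mono[OF assms(1)] by auto
  then have "s \<otimes> w = word_prod G v" using u v word_prod_closed[of v] by auto
  then have "\<ell> (s \<otimes> w) < \<ell> w" using len_le[of v] u v vS by simp
  then show ?thesis
    using that v vS inversion_iff gen_reflection parabolic_carrier assms by blast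
qed

text \<open>An inversion is crossed by a word over \<open>J\<close> for \<open>w\<close>; deletion
  puts \<open>r w\<close>, and hence \<open>r\<close>, into \<open>W_J\<close>.\<close>

lemma inversions_parabolic:
  assumes J: "J \<subseteq> S" and w: "w \<in> generate G J" and r: "r \<in> inversions w"
  shows "r \<in> generate G J"
proof -
  have c: "w \<in> carrier G" "r \<in> carrier G" using parabolic_carrier inversions_carrier assms by auto
  obtain u where u: "u \<in> lists J" "word_prod G u = w" using parabolic_reduced_word[OF J w] by metis
  then have "crossings u r > 0"
    using inversions_word_prod[of u r] subsetD[OF lists_mono[OF J] u(1)] r c u(2) by (simp add: odd_pos)
  then obtain v where "v \<in> lists J" "word_prod G v = r \<otimes> w"
    using deletion[OF J u(1)] u c by metis
  then have "r \<otimes> w \<in> generate G J" using word_prod_parabolic[OF J] by metis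
  then have "r \<otimes> w \<otimes> inv w \<in> generate G J" using parabolic_mult[OF J] parabolic_inv[OF J] w by blast
  then show ?thesis using c by (simp add: m_assoc)
qed

section \<open>Shortest elements of right cosets of parabolic subgroups\<close>

definition min_coset_rep :: "'a set \<Rightarrow> 'a \<Rightarrow> bool" where
  "min_coset_rep J b \<longleftrightarrow> b \<in> carrier G \<and> (\<forall>u\<in>generate G J. \<ell> b \<le> \<ell> (u \<otimes> b))"

lemma ex_min_coset_rep:
  assumes J: "J \<subseteq> S" and w: "w \<in> carrier G"
  obtains a b where "a \<in> generate G J" "min_coset_rep J b" "w = a \<otimes> b"
proof -
  obtain u where u: "u \<in> generate G J" "\<And>v. v \<in> generate G J \<Longrightarrow> \<ell> (u \<otimes> w) \<le> \<ell> (v \<otimes> w)"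
    using ex_has_least_nat[of "\<lambda>u. u \<in> generate G J" \<one> "\<lambda>u. \<ell> (u \<otimes> w)"] parabolic_one[OF J]
    by metis
  have c: "v \<in> carrier G" if "v \<in> generate G J" for v using parabolic_carrier J that by blast
  have "min_coset_rep J (u \<otimes> w)"
    unfolding min_coset_rep_def
    using u(2)[OF parabolic_mult[OF J _ u(1)]] w c c[OF u(1)] by (simp add: m_assoc)
  moreover have "w = inv u \<otimes> (u \<otimes> w)" using c u w by simp
  ultimately show ?thesis using that parabolic_inv[OF J u(1)] by blast
qed

lemma min_coset_rep_no_inversion:
  assumes "J \<subseteq> S" "min_coset_rep J b" "r \<in> generate G J" shows "r \<notin> inversions b"
  using inversion_imp_len_less[of b r] assms unfolding min_coset_rep_def by fastforce

text \<open>N(u) lies in \<open>W_J\<close>, while \<open>u N(b) u^-1\<close> avoids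
  \<open>W_J\<close> because N(b) does. The two sets are disjoint, so lengths add.\<close>

lemma len_min_coset_rep:
  assumes J: "J \<subseteq> S" and b: "min_coset_rep J b" and u: "u \<in> generate G J"
  shows "\<ell> (u \<otimes> b) = \<ell> u + \<ell> b"
proof (rule len_mult_disjoint)
  show c: "u \<in> carrier G" "b \<in> carrier G"
    using parabolic_carrier[OF J u] b by (auto simp: min_coset_rep_def)
  show "inversions u \<inter> conj_by u ` inversions b = {}"
  proof (rule ccontr)
    assume "inversions u \<inter> conj_by u ` inversions b \<noteq> {}"
    then obtain q where q: "q \<in> inversions b" "conj_by u q \<in> inversions u" by blast
    have "q = conj_by (inv u) (conj_by u q)"
      using c inversions_carrier[OF q(1)] by (simp add: m_assoc)
    moreover have "conj_by u q \<in> generate G J" using inversions_parabolic[OF J u] q by blast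
    ultimately have "q \<in> generate G J"
      using parabolic_mult[OF J] parabolic_inv[OF J] u by metis
    then show False using min_coset_rep_no_inversion[OF J b] q by blast
  qed
qed


section \<open>Longest elements\<close>

text \<open>Induction on the length of \<open>u = s v\<close>: as \<open>s\<close> is an inversion
  of \<open>a\<close> but not of \<open>v\<close>, the cocycle rule makes \<open>v^-1 s v\<close> an
  inversion of \<open>v^-1 a\<close>, and multiplying by it yields the shorter
  \<open>u^-1 a\<close>.\<close>

lemma len_left_factor:
  assumes J: "J \<subseteq> S" and a: "a \<in> generate G J" "J \<subseteq> inversions a" and u: "u \<in> generate G J"
  shows "\<ell> a = \<ell> u + \<ell> (inv u \<otimes> a)"
  using u
proof (induction "\<ell> u" arbitrary: u rule: less_induct)
  case less
  have c: "a \<in> carrier G" "u \<in> carrier G" using a less.prems parabolic_carrier[OF J] by auto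
  show ?case
  proof (cases "u = \<one>")
    case False
    then obtain s where s: "s \<in> J" "s \<in> inversions u" using parabolic_descent[OF J less.prems] by blast
    define v where "v = s \<otimes> u"
    have sS: "s \<in> S" using s J by blast
    have v: "v \<in> carrier G" "u = s \<otimes> v" "\<ell> u = \<ell> v + 1"
      using c sS inversion_len[OF c(2) sS s(2)] by (simp_all add: v_def)
    have "v \<in> generate G J" using less.prems s parabolic_mult[OF J] generate.incl unfolding v_def by metis
    then have IH: "\<ell> a = \<ell> v + \<ell> (inv v \<otimes> a)" using less.hyps v by simp
    have "s \<in> inversions (v \<otimes> (inv v \<otimes> a))" using a s c v by auto
    moreover have "s \<notin> inversions v" using inversion_imp_len_less[of v s] v by auto
    ultimately have "conj_by (inv v) s \<in> inversions (inv v \<otimes> a)"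
      using inversions_mult[of v "inv v \<otimes> a" s] v c sS by simp
    then have "\<ell> (conj_by (inv v) s \<otimes> (inv v \<otimes> a)) < \<ell> (inv v \<otimes> a)"
      using inversion_imp_len_less c v by simp
    also have "conj_by (inv v) s \<otimes> (inv v \<otimes> a) = inv u \<otimes> a"
      using c v sS by (simp add: m_assoc inv_mult_group)
    finally have "\<ell> u + \<ell> (inv u \<otimes> a) \<le> \<ell> a" using IH v by simp
    moreover have "\<ell> a \<le> \<ell> u + \<ell> (inv u \<otimes> a)" using len_mult_le[of u "inv u \<otimes> a"] c by simp
    ultimately show ?thesis by simp
  qed (use c in simp)
qed

lemma all_descents_maximal:
  assumes J: "J \<subseteq> S" and a: "a \<in> generate G J" "J \<subseteq> inversions a" and u: "u \<in> generate G J"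
  shows "\<ell> u \<le> \<ell> a" "\<ell> u = \<ell> a \<Longrightarrow> u = a"
proof -
  have c: "a \<in> carrier G" "u \<in> carrier G" using a u parabolic_carrier[OF J] by auto
  show "\<ell> u \<le> \<ell> a" using len_left_factor[OF J a u] by simp
  assume "\<ell> u = \<ell> a"
  then have "inv u \<otimes> a = \<one>" using len_left_factor[OF J a u] c len_0_iff by simp
  then show "u = a" using c by (metis inv_l_cancel(2) r_one)
qed

text \<open>\<open>J\<close> is contained in the finite set N(a), and lengths in \<open>W_J\<close>
  are bounded by that of \<open>a\<close>, so finitely many words over \<open>J\<close> exhaust
  \<open>W_J\<close>.\<close>

lemma all_descents_spherical:
  assumes J: "J \<subseteq> S" and a: "a \<in> generate G J" "J \<subseteq> inversions a"
  shows "spherical G S J"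
proof -
  have "finite J"
    using a card_inversions[OF parabolic_carrier[OF J a(1)]] finite_subset by blast
  then have "finite {u. set u \<subseteq> J \<and> length u \<le> \<ell> a}" by (rule finite_lists_length_le)
  moreover have "generate G J \<subseteq> word_prod G ` {u. set u \<subseteq> J \<and> length u \<le> \<ell> a}"
  proof
    fix w assume w: "w \<in> generate G J"
    obtain u where "u \<in> lists J" "word_prod G u = w" "length u = \<ell> w"
      using parabolic_reduced_word[OF J w] by metis
    then show "w \<in> word_prod G ` {u. set u \<subseteq> J \<and> length u \<le> \<ell> a}"
      using all_descents_maximal(1)[OF J a w] by auto
  qed
  ultimately show ?thesis using J finite_surj unfolding spherical_def by blast
qed

lemma longest_elem_eqI:
  assumes J: "J \<subseteq> S" and a: "a \<in> generate G J" "J \<subseteq> inversions a"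
  shows "longest_elem G S J = a"
  unfolding longest_elem_def
proof (rule the_equality)
  show "a \<in> generate G J \<and> (\<forall>u\<in>generate G J. \<ell> u \<le> \<ell> a)"
    using a all_descents_maximal(1)[OF J a] by blast
next
  fix w assume w: "w \<in> generate G J \<and> (\<forall>u\<in>generate G J. \<ell> u \<le> \<ell> w)"
  then have "\<ell> w = \<ell> a" using a all_descents_maximal(1)[OF J a] by (meson le_antisym)
  then show "w = a" using all_descents_maximal(2)[OF J a] w by blast
qed

text \<open>Finiteness gives an element \<open>a\<close> of maximal length; an \<open>s\<close> in
  \<open>J\<close> that is no inversion would make \<open>s a\<close> longer.\<close>

lemma longest_elem_spherical:
  assumes "spherical G S J"
  shows "longest_elem G S J \<in> generate G J" "J \<subseteq> inversions (longest_elem G S J)"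
proof -
  have J: "J \<subseteq> S" and fin: "finite (generate G J)" using assms by (auto simp: spherical_def)
  have ne: "\<ell> ` generate G J \<noteq> {}" using parabolic_one[OF J] by blast
  then obtain a where a: "a \<in> generate G J" "\<ell> a = Max (\<ell> ` generate G J)"
    using Max_in[of "\<ell> ` generate G J"] fin by fastforce
  then have max: "\<ell> u \<le> \<ell> a" if "u \<in> generate G J" for u using fin that by simp
  have "J \<subseteq> inversions a"
  proof
    fix s assume s: "s \<in> J"
    then have "s \<otimes> a \<in> generate G J" using a parabolic_mult[OF J] generate.incl by metis
    then have "\<ell> (s \<otimes> a) \<le> \<ell> a" by (rule max)
    then show "s \<in> inversions a"
      using not_inversion_len[of a s] parabolic_carrier[OF J a(1)] s J by force
  qed
  then have "longest_elem G S J = a" using longest_elem_eqI[OF J a(1)] by blast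
  then show "longest_elem G S J \<in> generate G J" "J \<subseteq> inversions (longest_elem G S J)"
    using a \<open>J \<subseteq> inversions a\<close> by auto
qed

lemma longest_elem_max:
  assumes "spherical G S J" "u \<in> generate G J"
  shows "\<ell> u \<le> \<ell> (longest_elem G S J)" "\<ell> u = \<ell> (longest_elem G S J) \<Longrightarrow> u = longest_elem G S J"
  using all_descents_maximal[OF _ longest_elem_spherical[OF assms(1)] assms(2)] assms(1)
  by (auto simp: spherical_def)

lemma len_gen: "s \<in> S \<Longrightarrow> \<ell> s = 1"
  using not_inversion_len[of \<one> s] by simp

text \<open>The inverse of \<open>u d^-1\<close> is \<open>(d u^-1 d^-1) d\<close>, an element of
  \<open>W_J d\<close>, hence not shorter than \<open>d\<close>.\<close>

lemma min_coset_rep_inv: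
  assumes J': "J' \<subseteq> S" and d: "min_coset_rep J d"
    and conj: "\<And>u. u \<in> generate G J' \<Longrightarrow> conj_by d u \<in> generate G J"
  shows "min_coset_rep J' (inv d)"
  unfolding min_coset_rep_def
proof (intro conjI ballI)
  have c: "d \<in> carrier G" using d by (simp add: min_coset_rep_def)
  then show "inv d \<in> carrier G" by simp
  fix u assume u: "u \<in> generate G J'"
  have cu: "u \<in> carrier G" by (rule parabolic_carrier[OF J' u])
  have "\<ell> d \<le> \<ell> (conj_by d (inv u) \<otimes> d)"
    using d conj[OF parabolic_inv[OF J' u]] unfolding min_coset_rep_def by blast
  also have "conj_by d (inv u) \<otimes> d = inv (u \<otimes> inv d)"
    using c cu by (simp add: m_assoc inv_mult_group)
  finally show "\<ell> (inv d) \<le> \<ell> (u \<otimes> inv d)" using c cu by (simp add: len_inv)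
qed

text \<open>The length of \<open>d u\<close> is computed twice, from \<open>(d u d^-1) d\<close> and
  from its inverse \<open>u^-1 d^-1\<close>. Lengths add in both, and \<open>d\<close> contributes
  equally.\<close>

lemma len_conj_min_coset_rep:
  assumes J: "J \<subseteq> S" "min_coset_rep J d" and J': "J' \<subseteq> S" "min_coset_rep J' (inv d)"
    and u: "u \<in> generate G J'" "conj_by d u \<in> generate G J"
  shows "\<ell> (conj_by d u) = \<ell> u"
proof -
  have c: "d \<in> carrier G" "u \<in> carrier G"
    using J parabolic_carrier[OF J'(1) u(1)] by (auto simp: min_coset_rep_def)
  have "\<ell> (conj_by d u) + \<ell> d = \<ell> (conj_by d u \<otimes> d)"
    using len_min_coset_rep[OF J u(2)] by simp
  also have "conj_by d u \<otimes> d = inv (inv u \<otimes> inv d)" using c by (simp add: m_assoc inv_mult_group)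
  also have "\<ell> \<dots> = \<ell> u + \<ell> d"
    using len_min_coset_rep[OF J' parabolic_inv[OF J'(1) u(1)]] c by (simp add: len_inv)
  finally show ?thesis by simp
qed

end


section \<open>Twisted involutions\<close>

text \<open>Fixing \<open>\<phi>\<close> by these properties keeps the definite description in
  \<open>twist\<close> out of the argument.\<close>

locale twisted_coxeter_system = coxeter_system +
  fixes \<phi> :: "'a \<Rightarrow> 'a"
  assumes twist_hom: "\<phi> \<in> hom G G"
    and twist_gen [simp]: "s \<in> S \<Longrightarrow> \<phi> s \<in> S"
    and twist_twist_gen: "s \<in> S \<Longrightarrow> \<phi> (\<phi> s) = s"
begin

lemma twist_closed [simp]: "x \<in> carrier G \<Longrightarrow> \<phi> x \<in> carrier G"
  using twist_hom by (auto simp: hom_def)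

lemma twist_mult [simp]: "x \<in> carrier G \<Longrightarrow> y \<in> carrier G \<Longrightarrow> \<phi> (x \<otimes> y) = \<phi> x \<otimes> \<phi> y"
  by (rule hom_mult[OF twist_hom])

lemma twist_one [simp]: "\<phi> \<one> = \<one>"
  using hom_one[OF twist_hom is_group is_group] .

lemma twist_inv [simp]: "x \<in> carrier G \<Longrightarrow> \<phi> (inv x) = inv (\<phi> x)"
  using inv_equality[of "\<phi> (inv x)" "\<phi> x"] by (simp flip: twist_mult)

lemma twist_twist [simp]:
  assumes "x \<in> carrier G" shows "\<phi> (\<phi> x) = x"
proof -
  have "(\<phi> \<circ> \<phi>) x = (\<lambda>x. x) x"
    by (rule hom_eqI[OF _ _ _ assms]) (auto simp: hom_def twist_twist_gen)
  then show ?thesis by simp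
qed

lemma len_twist:
  assumes "x \<in> carrier G" shows "\<ell> (\<phi> x) = \<ell> x"
proof -
  have le: "\<ell> (\<phi> y) \<le> \<ell> y" if y: "y \<in> carrier G" for y
  proof -
    obtain u where u: "u \<in> lists S" "word_prod G u = y" "length u = \<ell> y"
      using ex_reduced_word[OF y] by metis
    have "map \<phi> u \<in> lists S \<and> word_prod G (map \<phi> u) = \<phi> (word_prod G u)"
      using u(1) by induction (simp_all add: word_prod_closed)
    then show ?thesis using len_le[of "map \<phi> u"] u by simp
  qed
  show ?thesis using le[of x] le[of "\<phi> x"] assms by simp
qed

lemma twist_gen_inversion:
  assumes "x \<in> carrier G" "s \<in> S" shows "\<phi> s \<in> inversions (\<phi> x) \<longleftrightarrow> s \<in> inversions x"
  using inversion_iff[of x s] inversion_iff[of "\<phi> x" "\<phi> s"] len_twist[of "s \<otimes> x"] len_twist[of x] assms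
  by (simp add: gen_reflection)

section \<open>Reduction of twisted involutions by length-decreasing conjugation\<close>

abbreviation twisted_conj :: "'a \<Rightarrow> 'a \<Rightarrow> 'a" where
  "twisted_conj v w \<equiv> inv v \<otimes> w \<otimes> \<phi> v"

text \<open>For a \<sigma>-involution this is local minimality: by \<open>exchange\<close>, no
  twisted conjugation by a single generator shortens \<open>w\<close>.\<close>

definition irreducible :: "'a \<Rightarrow> bool" where
  "irreducible w \<longleftrightarrow> (\<forall>s\<in>S. s \<in> inversions w \<longrightarrow> s \<otimes> w = w \<otimes> \<phi> s)"

text \<open>\<open>\<phi>\<close> sends \<open>s w\<close> to the inverse of
  \<open>w \<phi>(s)\<close>. Thus \<open>\<phi>\<close> matches left descents of \<open>w\<close>
  with right descents.\<close>

lemma len_right_mult: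
  assumes "w \<in> carrier G" "\<phi> w = inv w" "s \<in> S"
  shows "\<ell> (w \<otimes> \<phi> s) = \<ell> (s \<otimes> w)"
  using len_twist[of "s \<otimes> w"] len_inv[of "w \<otimes> \<phi> s"] assms by (simp add: inv_mult_group)

text \<open>Split off the shortest element \<open>b\<close> of \<open>W_J w\<close>. It has no
  inversions in \<open>W_J\<close>, so \<open>a\<close> inherits all descents in \<open>J\<close>; a
  right descent of \<open>b\<close> would contradict its minimality.\<close>

lemma irreducible_eq_longest:
  assumes w: "w \<in> carrier G" "\<phi> w = inv w" and irr: "irreducible w"
  defines "J \<equiv> {s \<in> S. s \<in> inversions w}"
  shows "spherical G S J" "w = longest_elem G S J"
proof -
  have J: "J \<subseteq> S" by (auto simp: J_def)
  obtain a b where ab: "a \<in> generate G J" "min_coset_rep J b" "w = a \<otimes> b"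
    by (rule ex_min_coset_rep[OF J w(1)])
  have c: "a \<in> carrier G" "b \<in> carrier G"
    using ab parabolic_carrier[OF J] by (auto simp: min_coset_rep_def)
  have conj: "conj_by (inv a) s \<in> generate G J" if "s \<in> J" for s
    using parabolic_mult[OF J] parabolic_inv[OF J] ab(1) generate.incl[of s J G] that by simp
  have desc: "J \<subseteq> inversions a"
  proof
    fix s assume s: "s \<in> J"
    have "s \<in> inversions (a \<otimes> b)" using s ab(3) by (simp add: J_def)
    moreover have "conj_by (inv a) s \<notin> inversions b"
      by (rule min_coset_rep_no_inversion[OF J ab(2) conj[OF s]])
    ultimately show "s \<in> inversions a" using inversions_mult[of a b s] c s J by auto
  qed
  have "b = \<one>"
  proof (rule ccontr)
    assume "b \<noteq> \<one>"
    then have "inv b \<noteq> \<one>" using c by (metis inv_inv inv_one)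
    then obtain t where t: "t \<in> S" "t \<in> inversions (inv b)"
      using ex_left_descent[of "inv b"] c by blast
    have bt: "\<ell> (b \<otimes> t) < \<ell> b"
      using inversion_imp_len_less[of "inv b" t] len_inv[of "b \<otimes> t"] t c
      by (simp add: inv_mult_group len_inv)
    \<comment> \<open>Chosen so that the right descent \<open>t\<close> of \<open>w\<close>
      corresponds to the left descent \<open>s\<close>.\<close>
    define s where "s = \<phi> t"
    have s: "s \<in> S" "\<phi> s = t" using t by (simp_all add: s_def)
    have "\<ell> (s \<otimes> w) = \<ell> (a \<otimes> (b \<otimes> t))"
      using len_right_mult[OF w s(1)] s c t ab(3) by (simp add: m_assoc)
    also have "\<dots> \<le> \<ell> a + \<ell> (b \<otimes> t)" using len_mult_le c t by simp
    also have "\<dots> < \<ell> w" using len_min_coset_rep[OF J ab(2,1)] ab(3) bt by simp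
    finally have sw: "s \<in> inversions w" using inversion_iff[OF w(1) gen_reflection[OF s(1)]] by simp
    then have "s \<otimes> w = w \<otimes> t" using irr s unfolding irreducible_def by metis
    then have "inv a \<otimes> (s \<otimes> (a \<otimes> b)) = inv a \<otimes> (a \<otimes> b \<otimes> t)" using ab(3) by simp
    \<comment> \<open>This places \<open>b t\<close> in \<open>W_J b\<close>, although it is shorter
      than \<open>b\<close>.\<close>
    then have "b \<otimes> t = conj_by (inv a) s \<otimes> b" using c s t by (simp add: m_assoc)
    moreover have "conj_by (inv a) s \<in> generate G J" using conj sw s by (simp add: J_def)
    ultimately show False using len_min_coset_rep[OF J ab(2)] bt by (metis le_add2 not_le)
  qed
  then have "w = a" using ab c by simp
  then show "spherical G S J" "w = longest_elem G S J"
    using all_descents_spherical[OF J ab(1) desc] longest_elem_eqI[OF J ab(1) desc] by simp_all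
qed

text \<open>A descent violating irreducibility allows a twisted conjugation that lowers the length
  by exactly two; the generators used are collected in \<open>v\<close>.\<close>

lemma ex_irreducible_reduction:
  assumes "w \<in> carrier G" "\<phi> w = inv w"
  obtains v where "v \<in> carrier G" "\<ell> (twisted_conj v w) + 2 * \<ell> v = \<ell> w" "irreducible (twisted_conj v w)"
proof -
  have "\<exists>v\<in>carrier G. \<ell> (twisted_conj v w) + 2 * \<ell> v = \<ell> w \<and> irreducible (twisted_conj v w)"
    using assms
  proof (induction "\<ell> w" arbitrary: w rule: less_induct)
    case less
    show ?case
    proof (cases "irreducible w")
      case True
      then show ?thesis using less.prems by (intro bexI[of _ \<one>]) auto
    next
      case False
      then obtain s where s: "s \<in> S" "s \<in> inversions w" "s \<otimes> w \<noteq> w \<otimes> \<phi> s"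
        unfolding irreducible_def by blast
      define w' where "w' = s \<otimes> w \<otimes> \<phi> s"
      have c: "w \<in> carrier G" "w' \<in> carrier G" using less.prems s by (simp_all add: w'_def)
      have "\<ell> (w \<otimes> \<phi> s) < \<ell> w"
        using inversion_imp_len_less[OF c(1) s(2)] len_right_mult less.prems s by simp
      then have len: "\<ell> w' + 2 = \<ell> w"
        using exchange[of w s "\<phi> s"] less.prems s unfolding w'_def by simp
      have "\<phi> w' = inv w'" using less.prems s by (simp add: w'_def inv_mult_group m_assoc)
      then obtain v where v: "v \<in> carrier G" "\<ell> (twisted_conj v w') + 2 * \<ell> v = \<ell> w'"
        "irreducible (twisted_conj v w')"
        using less.hyps[of w'] len c by auto
      have eq: "twisted_conj v w' = twisted_conj (s \<otimes> v) w"
        using s v c by (simp add: w'_def inv_mult_group m_assoc)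
      have sv: "\<ell> (s \<otimes> v) \<le> \<ell> v + 1" using len_mult_le[of s v] len_gen s v by simp
      define z where "z = twisted_conj (s \<otimes> v) w"
      have z: "z \<in> carrier G" using s v c by (simp add: z_def)
      \<comment> \<open>Undoing the conjugation bounds the length of \<open>w\<close> from above by
        that of \<open>z\<close> plus twice that of \<open>s v\<close>. With \<open>sv\<close> as
        the opposite bound, equality follows.\<close>
      have "w = s \<otimes> v \<otimes> (z \<otimes> inv (\<phi> (s \<otimes> v)))"
        using s v c by (simp add: z_def m_assoc inv_mult_group)
      then have "\<ell> w \<le> \<ell> (s \<otimes> v) + \<ell> (z \<otimes> inv (\<phi> (s \<otimes> v)))"
        using len_mult_le[of "s \<otimes> v" "z \<otimes> inv (\<phi> (s \<otimes> v))"] s v z by (simp del: twist_mult)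
      also have "\<dots> \<le> \<ell> (s \<otimes> v) + (\<ell> z + \<ell> (s \<otimes> v))"
        using len_mult_le[of z "inv (\<phi> (s \<otimes> v))"] s v z by (simp add: len_inv len_twist del: twist_mult)
      finally have "\<ell> z + 2 * \<ell> (s \<otimes> v) = \<ell> w" using sv v len eq unfolding z_def by simp
      then show ?thesis using s v eq unfolding z_def by (intro bexI[of _ "s \<otimes> v"]) auto
    qed
  qed
  then show ?thesis using that by blast
qed

text \<open>Conjugates of generators in \<open>J\<close> are shown to be inversions of the longest
  element for \<open>J'\<close>, and all of these lie in \<open>W_J'\<close>.\<close>

lemma conj_parabolic:
  assumes J: "spherical G S J" and J': "spherical G S J'"
    and comm: "\<And>s. s \<in> J \<Longrightarrow> s \<otimes> longest_elem G S J = longest_elem G S J \<otimes> \<phi> s"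
    and x: "x \<in> carrier G" "longest_elem G S J' = twisted_conj x (longest_elem G S J)"
    and u: "u \<in> generate G J"
  shows "conj_by (inv x) u \<in> generate G J'"
proof -
  define a where "a = longest_elem G S J"
  have JS: "J \<subseteq> S" "J' \<subseteq> S" using J J' by (auto simp: spherical_def)
  have a: "a \<in> carrier G"
    using longest_elem_spherical(1)[OF J] parabolic_carrier[OF JS(1)] by (simp add: a_def)
  have gen: "conj_by (inv x) s \<in> generate G J'" if s: "s \<in> J" for s
  proof -
    have sS: "s \<in> S" using s JS by blast
    have "inv a \<otimes> (s \<otimes> a) = \<phi> s" using comm[OF s] a sS by (simp flip: a_def)
    then have conj_a: "conj_by (inv a) s = \<phi> s" using a sS by (simp add: m_assoc)
    let ?r = "conj_by (inv x) s"
    have conj_x: "conj_by x ?r = s" using x sS by (simp add: m_assoc)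
    have "?r \<in> inversions (inv x \<otimes> (a \<otimes> \<phi> x)) \<longleftrightarrow> (?r \<in> inversions (inv x)) \<noteq> (s \<in> inversions (a \<otimes> \<phi> x))"
      using inversions_mult[of "inv x" "a \<otimes> \<phi> x" ?r] conj_x x a sS by simp
    also have "?r \<in> inversions (inv x) \<longleftrightarrow> s \<in> inversions x"
      by (rule inversions_inv) (use x sS in auto)
    also have "s \<in> inversions (a \<otimes> \<phi> x) \<longleftrightarrow> (s \<in> inversions a) \<noteq> (\<phi> s \<in> inversions (\<phi> x))"
      using inversions_mult[of a "\<phi> x" s] conj_a x a sS by simp
    finally have "?r \<in> inversions (inv x \<otimes> (a \<otimes> \<phi> x)) \<longleftrightarrow>
      (s \<in> inversions x) \<noteq> ((s \<in> inversions a) \<noteq> (\<phi> s \<in> inversions (\<phi> x)))" .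
    \<comment> \<open>The terms for \<open>x^-1\<close> and \<open>\<phi> x\<close> cancel by
      \<open>twist_gen_inversion\<close>, so only membership of \<open>s\<close> in N(a)
      decides.\<close>
    moreover have "s \<in> inversions a" using longest_elem_spherical(2)[OF J] s by (auto simp: a_def)
    ultimately have "?r \<in> inversions (longest_elem G S J')"
      using twist_gen_inversion[OF x(1) sS] x a by (simp add: m_assoc flip: a_def)
    then show ?thesis
      by (rule inversions_parabolic[OF JS(2) longest_elem_spherical(1)[OF J']])
  qed
  from u show ?thesis
  proof induction
    case one
    then show ?case using x generate.one[of G J'] by simp
  next
    case (incl s)
    then show ?case by (rule gen)
  next
    case (inv s)
    then show ?case using gen[OF inv] JS by (metis gen_inv subsetD)
  next
    case (eng y z)
    have "y \<in> carrier G" "z \<in> carrier G" using eng parabolic_carrier[OF JS(1)] by auto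
    then have "conj_by (inv x) (y \<otimes> z) = conj_by (inv x) y \<otimes> conj_by (inv x) z"
      using x by (simp add: m_assoc)
    then show ?case using parabolic_mult[OF JS(2)] eng by simp
  qed
qed

lemma parabolic_commute:
  assumes J: "J \<subseteq> S" and a: "a \<in> carrier G" and comm: "\<And>s. s \<in> J \<Longrightarrow> s \<otimes> a = a \<otimes> \<phi> s"
    and u: "u \<in> generate G J"
  shows "u \<otimes> a = a \<otimes> \<phi> u"
  using u
proof induction
  case (inv s)
  then show ?case using J comm by (metis gen_inv subsetD)
next
  case (eng y z)
  have c: "y \<in> carrier G" "z \<in> carrier G" using eng parabolic_carrier[OF J] by auto
  have "y \<otimes> z \<otimes> a = y \<otimes> a \<otimes> \<phi> z" using c a eng.IH(2) by (simp add: m_assoc)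
  also have "\<dots> = a \<otimes> \<phi> (y \<otimes> z)" using c a by (simp add: eng.IH(1)) (simp add: m_assoc)
  finally show ?case .
qed (use a comm in auto)

text \<open>For \<open>x = b d\<close> with \<open>d\<close> shortest in \<open>W_J x\<close>,
  conjugation by \<open>d\<close> matches \<open>W_J'\<close> with \<open>W_J\<close> and preserves
  length. Hence it matches the longest elements, and also the elements of length one, which are the
  generators.\<close>

lemma longest_twisted_conj:
  assumes J: "spherical G S J" and J': "spherical G S J'"
    and comm: "\<And>s. s \<in> J \<Longrightarrow> s \<otimes> longest_elem G S J = longest_elem G S J \<otimes> \<phi> s"
    and comm': "\<And>s. s \<in> J' \<Longrightarrow> s \<otimes> longest_elem G S J' = longest_elem G S J' \<otimes> \<phi> s"
    and x: "x \<in> carrier G" "longest_elem G S J' = twisted_conj x (longest_elem G S J)"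
  obtains d where "d \<in> carrier G" "\<phi> d = d" "J' = conj_by (inv d) ` J"
    "\<ell> (longest_elem G S J') = \<ell> (longest_elem G S J)"
proof -
  define a a' where "a = longest_elem G S J" and "a' = longest_elem G S J'"
  have JS: "J \<subseteq> S" "J' \<subseteq> S" using J J' by (auto simp: spherical_def)
  have aJ: "a \<in> generate G J" "a' \<in> generate G J'"
    using longest_elem_spherical(1)[OF J] longest_elem_spherical(1)[OF J'] by (simp_all add: a_def a'_def)
  have a: "a \<in> carrier G" "a' \<in> carrier G" using aJ parabolic_carrier JS by auto
  have xa: "a' = twisted_conj x a" using x by (simp add: a_def a'_def)
  \<comment> \<open>With the roles of \<open>J\<close> and \<open>J'\<close> exchanged,
    \<open>conj_parabolic\<close> gives the opposite inclusion.\<close>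
  have "a = twisted_conj (inv x) a'" using x a by (simp add: xa m_assoc)
  then have x_conj': "conj_by x u \<in> generate G J" if "u \<in> generate G J'" for u
    using conj_parabolic[OF J' J comm', of "inv x" u] that x by (simp add: a_def a'_def)
  have x_conj: "conj_by (inv x) u \<in> generate G J'" if "u \<in> generate G J" for u
    using conj_parabolic[OF J J' comm x] that by blast
  obtain b d where bd: "b \<in> generate G J" "min_coset_rep J d" "x = b \<otimes> d"
    by (rule ex_min_coset_rep[OF JS(1) x(1)])
  have c: "b \<in> carrier G" "d \<in> carrier G"
    using bd parabolic_carrier[OF JS(1)] by (auto simp: min_coset_rep_def)
  have d_conj': "conj_by d u \<in> generate G J" if u: "u \<in> generate G J'" for u
  proof -
    have "u \<in> carrier G" using parabolic_carrier JS u by blast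
    then have "conj_by d u = inv b \<otimes> conj_by x u \<otimes> b"
      using c bd(3) by (simp add: m_assoc inv_mult_group)
    then show ?thesis
      using parabolic_mult[OF JS(1)] parabolic_inv[OF JS(1)] bd(1) x_conj'[OF u] by simp
  qed
  have d_conj: "conj_by (inv d) u \<in> generate G J'" if u: "u \<in> generate G J" for u
  proof -
    have "u \<in> carrier G" using parabolic_carrier JS u by blast
    then have "conj_by (inv d) u = conj_by (inv x) (conj_by b u)"
      using c bd(3) by (simp add: m_assoc inv_mult_group)
    then show ?thesis
      using parabolic_mult[OF JS(1)] parabolic_inv[OF JS(1)] bd(1) u x_conj by simp
  qed
  have min': "min_coset_rep J' (inv d)" by (rule min_coset_rep_inv[OF JS(2) bd(2) d_conj'])
  have len': "\<ell> (conj_by d u) = \<ell> u" if "u \<in> generate G J'" for u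
    by (rule len_conj_min_coset_rep[OF JS(1) bd(2) JS(2) min' that d_conj'[OF that]])
  have "min_coset_rep J (inv (inv d))" using bd(2) c by simp
  from len_conj_min_coset_rep[OF JS(2) min' JS(1) this]
  have len: "\<ell> (conj_by (inv d) u) = \<ell> u" if "u \<in> generate G J" for u
    using that d_conj by blast
  have "\<ell> a' \<le> \<ell> a"
    using longest_elem_max(1)[OF J d_conj'[OF aJ(2)]] len'[OF aJ(2)] by (simp add: a_def)
  moreover have "\<ell> a \<le> \<ell> a'"
    using longest_elem_max(1)[OF J' d_conj[OF aJ(1)]] len[OF aJ(1)] by (simp add: a'_def)
  ultimately have len_eq: "\<ell> a' = \<ell> a" by simp
  then have "conj_by (inv d) a = a'"
    using longest_elem_max(2)[OF J' d_conj[OF aJ(1)]] len[OF aJ(1)] by (simp add: a'_def)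
  \<comment> \<open>The factor \<open>b\<close> drops out since \<open>b a = a \<phi>(b)\<close>.
    Comparing with the ordinary conjugate \<open>d^-1 a d = a'\<close> then forces
    \<open>\<phi> d = d\<close>.\<close>
  moreover have "a' = twisted_conj d a"
  proof -
    have "b \<otimes> a = a \<otimes> \<phi> b" using parabolic_commute[OF JS(1) a(1) _ bd(1)] comm by (simp add: a_def)
    have "a' = inv d \<otimes> (inv b \<otimes> (a \<otimes> \<phi> b) \<otimes> \<phi> d)"
      unfolding xa bd(3) using c a by (simp add: m_assoc inv_mult_group)
    also have "inv b \<otimes> (a \<otimes> \<phi> b) = a" unfolding \<open>b \<otimes> a = a \<otimes> \<phi> b\<close>[symmetric] using c a by simp
    finally show ?thesis using c a by (simp add: m_assoc)
  qed
  ultimately have "\<phi> d = d" using c a by (simp add: m_assoc)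
  moreover have "J' = conj_by (inv d) ` J"
  proof (intro equalityI subsetI)
    fix s assume s: "s \<in> J'"
    then have sS: "s \<in> S" and sg: "s \<in> generate G J'" using JS generate.incl by auto
    have "conj_by d s \<in> J"
      using parabolic_gen[OF JS(1) d_conj'[OF sg]] len'[OF sg] len_gen[OF sS] by simp
    moreover have "s = conj_by (inv d) (conj_by d s)" using c sS by (simp add: m_assoc)
    ultimately show "s \<in> conj_by (inv d) ` J" by blast
  next
    fix r assume "r \<in> conj_by (inv d) ` J"
    then obtain s where s: "s \<in> J" "r = conj_by (inv d) s" by blast
    then have sS: "s \<in> S" and sg: "s \<in> generate G J" using JS generate.incl by auto
    show "r \<in> J'"
      using parabolic_gen[OF JS(2) d_conj[OF sg]] len[OF sg] len_gen[OF sS] s(2) by simp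
  qed
  ultimately show ?thesis using that c len_eq unfolding a_def a'_def by blast
qed

text \<open>Both elements are longest elements of the subgroups generated by their descent sets.
  Equal lengths make local minimality global within a class.\<close>

lemma irreducible_len_eq:
  assumes "w \<in> carrier G" "\<phi> w = inv w" "irreducible w"
    and "w' \<in> carrier G" "\<phi> w' = inv w'" "irreducible w'"
    and "x \<in> carrier G" "w' = twisted_conj x w"
  shows "\<ell> w' = \<ell> w"
proof -
  define J J' where "J = {s \<in> S. s \<in> inversions w}" and "J' = {s \<in> S. s \<in> inversions w'}"
  have J: "spherical G S J" "w = longest_elem G S J"
    using irreducible_eq_longest[OF assms(1-3)] by (simp_all add: J_def)
  have J': "spherical G S J'" "w' = longest_elem G S J'"
    using irreducible_eq_longest[OF assms(4-6)] by (simp_all add: J'_def)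
  have comm: "s \<otimes> w = w \<otimes> \<phi> s" if "s \<in> J" for s
    using assms(3) that by (simp add: irreducible_def J_def)
  have comm': "s \<otimes> w' = w' \<otimes> \<phi> s" if "s \<in> J'" for s
    using assms(6) that by (simp add: irreducible_def J'_def)
  show ?thesis
    by (rule longest_twisted_conj[OF J(1) J'(1), folded J(2) J'(2), OF comm comm' assms(7,8)])
qed

end


theorem theorem1p9:
  fixes G :: "('a, 'b) monoid_scheme" (structure)
    and S C :: "'a set" and \<sigma> :: "'a \<Rightarrow> 'a"
  assumes "coxeter_system G S"
    and "coxeter_graph_aut G S \<sigma>"
    and "\<exists>w\<^sub>0 \<in> carrier G. C = twisted_class G S \<sigma> w\<^sub>0"
    and "\<forall>w \<in> C. twisted_involution G S \<sigma> w"
  shows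
    "(\<forall>w \<in> min_length_elems G S C.
        \<exists>J. spherical G S J \<and> w = longest_elem G S J \<and>
            (\<forall>s\<in>J. s \<otimes> longest_elem G S J = longest_elem G S J \<otimes> twist G S \<sigma> s))
     \<and> (\<forall>J J'. spherical G S J \<and> spherical G S J' \<and>
            longest_elem G S J \<in> min_length_elems G S C \<and>
            longest_elem G S J' \<in> min_length_elems G S C \<longrightarrow>
            (\<exists>w \<in> carrier G. J' = {w \<otimes> s \<otimes> twist G S \<sigma> (inv w) | s. s \<in> J}))
     \<and> (\<forall>w \<in> C. \<exists>v \<in> carrier G.
            int (coxeter_length G S (inv v \<otimes> w \<otimes> twist G S \<sigma> v))
              = int (coxeter_length G S w) - 2 * int (coxeter_length G S v) \<and>
            (\<exists>J. spherical G S J \<and> inv v \<otimes> w \<otimes> twist G S \<sigma> v = longest_elem G S J \<and>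
                 longest_elem G S J \<in> min_length_elems G S C))"
proof -
  define \<phi> where "\<phi> = twist G S \<sigma>"
  interpret coxeter_system G S by fact
  obtain w\<^sub>0 where w0: "w\<^sub>0 \<in> carrier G" and C: "C = twisted_class G S \<sigma> w\<^sub>0" using assms(3) by blast
  have \<phi>: "\<phi> \<in> hom G G" "\<And>s. s \<in> S \<Longrightarrow> \<phi> s = \<sigma> s"
    using twist_auto[OF assms(2)] by (auto simp: \<phi>_def auto_def)
  have mem_C: "w \<in> C \<longleftrightarrow> (\<exists>v\<in>carrier G. w = inv v \<otimes> w\<^sub>0 \<otimes> \<phi> v)" for w
    unfolding C twisted_class_def \<phi>_def by blast
  have "\<phi> \<one> = \<one>" using hom_one[OF \<phi>(1) is_group is_group] .
  \<comment> \<open>A member of the class is required to extract \<sigma>^2 = 1, which is part of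
    \<open>twisted_involution\<close>.\<close>
  then have "w\<^sub>0 \<in> C" unfolding mem_C using w0 by (intro bexI[of _ \<one>]) auto
  then have \<sigma>\<sigma>: "\<sigma> (\<sigma> s) = s" if "s \<in> S" for s using assms(4) that by (auto simp: twisted_involution_def)
  have \<sigma>S: "\<sigma> s \<in> S" if "s \<in> S" for s
    using assms(2) that by (auto simp: coxeter_graph_aut_def bij_betw_def)
  interpret twisted_coxeter_system G S \<phi>
    by unfold_locales (use \<phi> \<sigma>\<sigma> \<sigma>S in auto)
  have inC: "w \<in> carrier G \<and> \<phi> w = inv w" if "w \<in> C" for w
  proof -
    have w: "w \<in> carrier G" "w \<otimes> \<phi> w = \<one>"
      using assms(4) that by (auto simp: twisted_involution_def \<phi>_def)
    then show ?thesis using inv_equality[of w "\<phi> w"] by (metis inv_inv twist_closed)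
  qed
  have C_conj: "twisted_conj v w \<in> C" if w: "w \<in> C" and v: "v \<in> carrier G" for v w
  proof -
    obtain z where "z \<in> carrier G" "w = twisted_conj z w\<^sub>0"
      using w unfolding mem_C by (rule bexE)
    then have "twisted_conj v w = twisted_conj (z \<otimes> v) w\<^sub>0" "z \<otimes> v \<in> carrier G"
      using v w0 by (simp_all add: m_assoc inv_mult_group)
    then show ?thesis unfolding mem_C by (intro bexI)
  qed
  have C_trans: "\<exists>x\<in>carrier G. w' = twisted_conj x w" if w: "w \<in> C" and w': "w' \<in> C" for w w'
  proof -
    obtain z where z: "z \<in> carrier G" "w = twisted_conj z w\<^sub>0"
      using w unfolding mem_C by (rule bexE)
    obtain z' where z': "z' \<in> carrier G" "w' = twisted_conj z' w\<^sub>0"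
      using w' unfolding mem_C by (rule bexE)
    with z have "w' = twisted_conj (inv z \<otimes> z') w" using w0 by (simp add: m_assoc inv_mult_group)
    then show ?thesis using z(1) z'(1) by blast
  qed
  \<comment> \<open>Any \<open>u\<close> in the class reduces to an irreducible element that is no
    longer than \<open>u\<close> and has the same length as \<open>w\<close>.\<close>
  have irr_min: "w \<in> min_length_elems G S C" if w: "w \<in> C" "irreducible w" for w
    unfolding min_length_elems_def
  proof (intro CollectI conjI ballI)
    fix u assume u: "u \<in> C"
    obtain v where v: "v \<in> carrier G" "\<ell> (twisted_conj v u) + 2 * \<ell> v = \<ell> u" "irreducible (twisted_conj v u)"
      using ex_irreducible_reduction inC[OF u] by blast
    have vC: "twisted_conj v u \<in> C" by (rule C_conj[OF u v(1)])
    obtain x where "x \<in> carrier G" "twisted_conj v u = twisted_conj x w"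
      using C_trans[OF w(1) vC] by blast
    then have "\<ell> (twisted_conj v u) = \<ell> w"
      using irreducible_len_eq[of w "twisted_conj v u" x] inC[OF w(1)] inC[OF vC] w v by blast
    then show "\<ell> w \<le> \<ell> u" using v by simp
  qed (rule w)
  \<comment> \<open>Reducing a minimal \<open>w\<close> cannot lower its length, so the conjugating
    \<open>v\<close> has length 0 and is trivial.\<close>
  have min_irr: "w \<in> C \<and> irreducible w" if "w \<in> min_length_elems G S C" for w
  proof -
    have w: "w \<in> C" "\<And>u. u \<in> C \<Longrightarrow> \<ell> w \<le> \<ell> u" using that by (auto simp: min_length_elems_def)
    obtain v where v: "v \<in> carrier G" "\<ell> (twisted_conj v w) + 2 * \<ell> v = \<ell> w" "irreducible (twisted_conj v w)"
      using ex_irreducible_reduction inC[OF w(1)] by blast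
    then have "\<ell> v = 0" using w(2)[OF C_conj[OF w(1) v(1)]] by simp
    then have "v = \<one>" using v len_0_iff by simp
    then show ?thesis using w v inC[OF w(1)] by simp
  qed
  have 1: "\<exists>J. spherical G S J \<and> w = longest_elem G S J \<and>
      (\<forall>s\<in>J. s \<otimes> longest_elem G S J = longest_elem G S J \<otimes> \<phi> s)"
    if w: "w \<in> C" "irreducible w" for w
  proof -
    obtain J where J: "J = {s \<in> S. s \<in> inversions w}" by blast
    have sph: "spherical G S J" and eq: "longest_elem G S J = w"
      using irreducible_eq_longest[of w] inC[OF w(1)] w(2) unfolding J by simp_all
    have "\<forall>s\<in>J. s \<otimes> longest_elem G S J = longest_elem G S J \<otimes> \<phi> s"
      unfolding eq using w(2) J by (simp add: irreducible_def)
    then show ?thesis using sph eq by blast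
  qed
  have 2: "\<exists>w \<in> carrier G. J' = {w \<otimes> s \<otimes> \<phi> (inv w) | s. s \<in> J}"
    if J: "spherical G S J" "longest_elem G S J \<in> min_length_elems G S C"
      and J': "spherical G S J'" "longest_elem G S J' \<in> min_length_elems G S C" for J J'
  proof -
    \<comment> \<open>\<open>K\<close> is an arbitrary spherical set here; its elements are descents
      of its longest element, so irreducibility applies to them.\<close>
    have comm: "s \<otimes> longest_elem G S K = longest_elem G S K \<otimes> \<phi> s"
      if "spherical G S K" "longest_elem G S K \<in> min_length_elems G S C" "s \<in> K" for K s
      using min_irr[OF that(2)] longest_elem_spherical(2)[OF that(1)] that(1,3)
      unfolding irreducible_def spherical_def by blast
    obtain x where x: "x \<in> carrier G" "longest_elem G S J' = twisted_conj x (longest_elem G S J)"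
      using C_trans min_irr J(2) J'(2) by blast
    obtain d where d: "d \<in> carrier G" "\<phi> d = d" "J' = conj_by (inv d) ` J"
      by (rule longest_twisted_conj[OF J(1) J'(1) comm[OF J] comm[OF J'] x])
    \<comment> \<open>As \<open>\<phi>\<close> fixes \<open>d\<close>, ordinary conjugation is
      already the twisted one, with \<open>inv d\<close> as witness.\<close>
    then have "J' = {inv d \<otimes> s \<otimes> \<phi> (inv (inv d)) | s. s \<in> J}" by auto
    then show ?thesis using d by blast
  qed
  have 3: "\<exists>v \<in> carrier G. int (\<ell> (twisted_conj v w)) = int (\<ell> w) - 2 * int (\<ell> v) \<and>
      (\<exists>J. spherical G S J \<and> twisted_conj v w = longest_elem G S J \<and>
        longest_elem G S J \<in> min_length_elems G S C)"
    if w: "w \<in> C" for w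
  proof -
    obtain v where v: "v \<in> carrier G" "\<ell> (twisted_conj v w) + 2 * \<ell> v = \<ell> w" "irreducible (twisted_conj v w)"
      using ex_irreducible_reduction inC[OF w] by blast
    have vC: "twisted_conj v w \<in> C" by (rule C_conj[OF w v(1)])
    obtain J where "spherical G S J" "twisted_conj v w = longest_elem G S J"
      using 1[OF vC v(3)] by blast
    moreover have "int (\<ell> (twisted_conj v w)) = int (\<ell> w) - 2 * int (\<ell> v)" using v(2) by simp
    ultimately show ?thesis using irr_min[OF vC v(3)] v(1) by (intro bexI[of _ v]) auto
  qed
  show ?thesis
    unfolding \<phi>_def[symmetric] using 1 2 3 min_irr by (intro conjI allI impI ballI) blast+
qed

end
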